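(* Let $k$ be a positive integer and let $\delta_1,\ldots,\delta_m$ be positive integers with $\delta_i\ge p-1\ge 2$ for all $i$ and $kp=\delta_1+\cdots+ \delta_m$, where $p$ is an odd integer. Let $G$ be a $(3k-3)$-edge-connected graph satisfying $\delta(G)\ge \delta_1+\cdots+ \delta_m$. Then $G$ can be edge-decomposed into factors $G_1,\ldots, G_m$ satisfying $\delta(G_i)\ge \delta_i$ for all $i$ with $1\le i \le m$, if and only if at least one of the following conditions holds: (1) $|V(G)|$ is even; (2) $\sum_{v\in V(G)}\big(d_G(v)-(\delta_1+\cdots+ \delta_m)\big)\ge |\{i:\delta_i \text{ is odd}\}|-1$.
   Context: Graphs may have loops and multiple edges; $d_G(v)$ is the degree of $v$ in $G$ (a loop counts twice), and $\delta(G)$ is the minimum degree of $G$. A factor of $G$ is a spanning subgraph of $G$; $G$ is edge-decomposed into factors $G_1,\ldots,G_m$ if their edge sets partition $E(G)$. For a vertex set $A$, $d_G(A)$ is the number of edges of $G$ with exactly one end in $A$; $G$ is $\lambda$-edge-connected if $d_G(A)\ge\lambda$ for every nonempty proper subset $A$ of $V(G)$. *)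

theory Defs
  imports Main "HOL-Library.Uprod" "HOL-Library.Disjoint_Sets"
begin

text \<open>Undirected graphs in which edges have an identity of their own, so that there may be
  several edges with the same pair of ends; an edge \<open>e\<close> with \<open>ends G e = Upair v v\<close> is a loop.\<close>

record ('v, 'e) multigraph =
  verts :: "'v set"
  edges :: "'e set"
  ends :: "'e \<Rightarrow> 'v uprod"

definition is_graph :: "('v, 'e) multigraph \<Rightarrow> bool" where
  "is_graph G \<longleftrightarrow> finite (verts G) \<and> verts G \<noteq> {} \<and> finite (edges G) \<and>
     (\<forall>e\<in>edges G. set_uprod (ends G e) \<subseteq> verts G)"

text \<open>The second summand makes every loop count twice.\<close>

definition degree :: "('v, 'e) multigraph \<Rightarrow> 'v \<Rightarrow> nat" where
  "degree G v = card {e \<in> edges G. v \<in> set_uprod (ends G e)}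
              + card {e \<in> edges G. ends G e = Upair v v}"

definition min_degree :: "('v, 'e) multigraph \<Rightarrow> nat" where
  "min_degree G = Min (degree G ` verts G)"

definition cut_degree :: "('v, 'e) multigraph \<Rightarrow> 'v set \<Rightarrow> nat" where
  "cut_degree G A = card {e \<in> edges G. \<exists>u v. ends G e = Upair u v \<and> u \<in> A \<and> v \<notin> A}"

definition edge_connected :: "nat \<Rightarrow> ('v, 'e) multigraph \<Rightarrow> bool" where
  "edge_connected l G \<longleftrightarrow> (\<forall>A. A \<noteq> {} \<and> A \<subset> verts G \<longrightarrow> cut_degree G A \<ge> l)"

definition is_factor :: "('v, 'e) multigraph \<Rightarrow> ('v, 'e) multigraph \<Rightarrow> bool" where
  "is_factor H G \<longleftrightarrow> is_graph H \<and> verts H = verts G \<and> edges H \<subseteq> edges G \<and>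
     (\<forall>e\<in>edges H. ends H e = ends G e)"

definition edge_decomposition ::
    "('v, 'e) multigraph \<Rightarrow> 'i set \<Rightarrow> ('i \<Rightarrow> ('v, 'e) multigraph) \<Rightarrow> bool" where
  "edge_decomposition G I H \<longleftrightarrow> (\<forall>i\<in>I. is_factor (H i) G) \<and>
     disjoint_family_on (\<lambda>i. edges (H i)) I \<and> (\<Union>i\<in>I. edges (H i)) = edges G"

end

theory Submission
  imports Defs
begin

text \<open>Write \<open>d v\<close> for the degree of \<open>v\<close> in \<open>G\<close>, \<open>x v = d v - k * p\<close> for its excess, and \<open>s\<close> for the number of odd
\<open>\<delta> i\<close>. An odd \<open>\<delta> i\<close> is at least \<open>p\<close>, whence \<open>s \<le> k\<close>, and \<open>s\<close> and \<open>k\<close> have the same parity since \<open>p\<close> is odd.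

If the number of vertices is odd, a factor with odd \<open>\<delta> i\<close> cannot be \<open>\<delta> i\<close>-regular, so each such factor
uses up some excess; this is the necessity of the condition (lemma \<open>excess_of_decomposition\<close>).

For sufficiency, orient \<open>G\<close> with prescribed outdegrees modulo \<open>k\<close>, and then colour the edges with \<open>k\<close>
colours so that at each vertex both the out-edges and the in-edges are spread as evenly as possible over the
colours. Such a colouring exists because tails and heads make the edges into a bipartite graph
(\<open>equitable_colouring\<close>). If the outdegree of \<open>v\<close> is \<open>k * y + q v\<close> with \<open>0 \<le> q v \<le> x v\<close>, every colour
occurs on at least \<open>y\<close> out-edges and on at least \<open>p - y\<close> in-edges, and so has degree at least \<open>p\<close> at \<open>v\<close>. One
colour goes to each factor with odd \<open>\<delta> i\<close>. The other \<open>k - s\<close> colours together have degree at least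
\<open>(k - s) * p\<close> everywhere, and all that is still missing are even numbers \<open>\<delta> i - p\<close> and \<open>\<delta> i\<close> with this sum.
A graph of minimum degree at least \<open>2 * n\<close> splits into \<open>n\<close> factors of minimum degree at least 2: take an orientation in
which in- and outdegrees differ by at most one, and colour equitably with \<open>n\<close> colours (\<open>split_into_2_factors\<close>, a form of
Petersen's theorem).

The residues \<open>q v\<close> must sum up to the number of edges modulo \<open>k\<close>. Within the bounds \<open>0 \<le> q v \<le> x v\<close> this is possible unless
the number of vertices is odd and the total excess is less than \<open>k\<close>. In that case the total excess is at least
\<open>s\<close>, one vertex takes a larger residue, and there are enough colours to pair those with too small a degree at this
vertex with those of larger degree (\<open>residues\<close>, \<open>factor_classes\<close>).

The orientation exists by a theorem of Lovasz, Thomassen, Wu and Zhang: a \<open>(3 * k - 3)\<close>-edge-connected graph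
has an orientation with any prescribed outdegrees modulo \<open>k\<close> whose sum is right modulo \<open>k\<close>. Its proof by induction takes
most of this file (\<open>mod_orientation_exists\<close>).\<close>

section \<open>Counting edges by their ends\<close>

text \<open>A multigraph is given by a finite set \<open>E\<close> of edges and two maps \<open>a\<close> and \<open>b\<close> to the two ends of an edge. An orientation is
a map \<open>t\<close> that picks one end of each edge as its tail.\<close>

definition cut :: "'e set \<Rightarrow> ('e \<Rightarrow> 'v) \<Rightarrow> ('e \<Rightarrow> 'v) \<Rightarrow> 'v set \<Rightarrow> int" where
  "cut E a b A = (\<Sum>e\<in>E. of_bool ((a e \<in> A) \<noteq> (b e \<in> A)))"

definition inside :: "'e set \<Rightarrow> ('e \<Rightarrow> 'v) \<Rightarrow> ('e \<Rightarrow> 'v) \<Rightarrow> 'v set \<Rightarrow> int" where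
  "inside E a b A = (\<Sum>e\<in>E. of_bool (a e \<in> A \<and> b e \<in> A))"

text \<open>The outdegree of \<open>v\<close> if \<open>t\<close> is the tail map of an orientation; \<open>outs E a v + outs E b v\<close> is the degree of \<open>v\<close>,
loops counting twice.\<close>

definition outs :: "'e set \<Rightarrow> ('e \<Rightarrow> 'v) \<Rightarrow> 'v \<Rightarrow> int" where
  "outs E t v = (\<Sum>e\<in>E. of_bool (t e = v))"

lemma cut_compl: "cut E a b A = cut E a b B" if "\<And>e. e \<in> E \<Longrightarrow> (a e \<in> B) = (a e \<notin> A) \<and> (b e \<in> B) = (b e \<notin> A)"
  unfolding cut_def using that by (intro sum.cong) auto

lemma cut_remove:
  assumes "finite E" "e0 \<in> E"
  shows "cut (E - {e0}) a b A = cut E a b A - of_bool ((a e0 \<in> A) \<noteq> (b e0 \<in> A))"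
  unfolding cut_def using sum.remove[OF assms, of "\<lambda>e. of_bool ((a e \<in> A) \<noteq> (b e \<in> A)) :: int"] by linarith

lemma inside_remove:
  assumes "finite E" "e0 \<in> E"
  shows "inside (E - {e0}) a b A = inside E a b A - of_bool (a e0 \<in> A \<and> b e0 \<in> A)"
  unfolding inside_def using sum.remove[OF assms, of "\<lambda>e. of_bool (a e \<in> A \<and> b e \<in> A) :: int"] by linarith

lemma outs_remove:
  assumes "finite E" "e0 \<in> E"
  shows "outs E t v = outs (E - {e0}) t v + of_bool (t e0 = v)"
  unfolding outs_def using sum.remove[OF assms, of "\<lambda>e. of_bool (t e = v) :: int"] by linarith

lemma outs_cong: "(\<And>e. e \<in> E \<Longrightarrow> t e = t' e) \<Longrightarrow> outs E t v = outs E t' v"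
  unfolding outs_def by (intro sum.cong) auto

lemma cut_nonneg: "0 \<le> cut E a b A"
  unfolding cut_def by (intro sum_nonneg) auto

lemma dvd_subst: "(k::int) dvd x \<Longrightarrow> x = y \<Longrightarrow> k dvd y"
  by simp

lemma sum_fun_upd_int:
  fixes f :: "'v \<Rightarrow> int"
  assumes "finite A"
  shows "sum (f(x := y)) A = sum f A + (if x \<in> A then y - f x else 0)"
proof (cases "x \<in> A")
  case True
  then show ?thesis using assms by (simp add: sum.remove[of A x])
next
  case False
  then have "sum (f(x := y)) A = sum f A" by (intro sum.cong) auto
  then show ?thesis using False by simp
qed

lemma sum_outs:
  assumes "finite B"
  shows "sum (outs E t) B = (\<Sum>e\<in>E. of_bool (t e \<in> B))"
proof -
  have "sum (outs E t) B = (\<Sum>e\<in>E. \<Sum>v\<in>B. of_bool (t e = v))"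
    unfolding outs_def by (rule sum.swap)
  also have "\<dots> = (\<Sum>e\<in>E. of_bool (t e \<in> B))"
    using assms by (intro sum.cong refl) (simp add: of_bool_def)
  finally show ?thesis .
qed

lemma outs_split:
  assumes "finite E" "D \<subseteq> E"
  shows "outs E t v = outs D t v + outs (E - D) t v"
  unfolding outs_def using sum.subset_diff[OF assms(2,1)] by (simp only: add.commute)

lemma outs_mono:
  assumes "finite E" "D \<subseteq> E"
  shows "outs D t v \<le> outs E t v"
  unfolding outs_def using assms by (intro sum_mono2) auto

lemma outs_disjoint_Un:
  assumes "finite A" "finite B" "A \<inter> B = {}"
  shows "outs (A \<union> B) t v = outs A t v + outs B t v"
  unfolding outs_def using assms by (rule sum.union_disjoint)

lemma sum_degrees:
  assumes "finite A"
  shows "sum (outs E a) A + sum (outs E b) A = cut E a b A + 2 * inside E a b A"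
proof -
  have "sum (outs E a) A + sum (outs E b) A = (\<Sum>e\<in>E. of_bool (a e \<in> A) + of_bool (b e \<in> A))"
    unfolding sum_outs[OF assms] by (simp only: sum.distrib)
  also have "\<dots> = (\<Sum>e\<in>E. of_bool ((a e \<in> A) \<noteq> (b e \<in> A)) + 2 * of_bool (a e \<in> A \<and> b e \<in> A))"
    by (intro sum.cong) auto
  also have "\<dots> = cut E a b A + 2 * inside E a b A"
    unfolding cut_def inside_def by (simp only: sum.distrib sum_distrib_left)
  finally show ?thesis .
qed

lemma handshake:
  assumes "finite V" "\<And>e. e \<in> E \<Longrightarrow> a e \<in> V" "\<And>e. e \<in> E \<Longrightarrow> b e \<in> V"
  shows "(\<Sum>v\<in>V. outs E a v + outs E b v) = 2 * int (card E)"
proof -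
  have "cut E a b V = 0" unfolding cut_def using assms by (intro sum.neutral) auto
  moreover have "inside E a b V = int (card E)" unfolding inside_def using assms by simp
  ultimately show ?thesis using sum_degrees[OF assms(1), of E a b] by (simp add: sum.distrib)
qed

lemma outs_reorient:
  assumes "\<And>e. e \<in> D \<Longrightarrow> t e = a e \<or> t e = b e"
  shows "outs D t v + outs D (\<lambda>e. if t e = a e then b e else a e) v = outs D a v + outs D b v"
  unfolding outs_def sum.distrib[symmetric]
proof (intro sum.cong refl)
  fix e assume "e \<in> D"
  from assms[OF this] show "of_bool (t e = v) + of_bool ((if t e = a e then b e else a e) = v) =
    (of_bool (a e = v) + of_bool (b e = v) :: int)" by auto
qed

text \<open>Lifting replaces two edges \<open>e1\<close> and \<open>e2\<close> at \<open>v\<close> by one edge between their other ends \<open>y\<close> and \<open>w\<close>; here this edge is \<open>e1\<close> with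
new ends. Whatever its direction, it can be replaced by a directed path through \<open>v\<close>, which adds one to the
outdegree of \<open>v\<close> and changes no other outdegree.\<close>

lemma unlift:
  assumes fin: "finite E" and e: "e1 \<in> E" "e2 \<in> E" "e1 \<noteq> e2"
    and ends1: "{a e1, b e1} = {v, y}" and ends2: "{a e2, b e2} = {v, w}"
    and t: "\<And>e. e \<in> E - {e2} \<Longrightarrow> t e = (a(e1 := y)) e \<or> t e = (b(e1 := w)) e"
  obtains s where "\<And>e. e \<in> E \<Longrightarrow> s e = a e \<or> s e = b e"
    "\<And>u. outs E s u = outs (E - {e2}) t u + of_bool (u = v)"
proof -
  define s where "s = t(e1 := (if t e1 = y then y else v), e2 := (if t e1 = y then v else w))"
  have te1: "t e1 = y \<or> t e1 = w" using t[of e1] e by auto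
  have s12: "s e1 = (if t e1 = y then y else v)" "s e2 = (if t e1 = y then v else w)"
    unfolding s_def using e(3) by auto
  have fE': "finite (E - {e2})" "e1 \<in> E - {e2}" using fin e by auto
  show thesis
  proof (rule that)
    fix u
    have "outs E s u = outs (E - {e2}) s u + of_bool (s e2 = u)"
      by (rule outs_remove[OF fin e(2)])
    also have "outs (E - {e2}) s u = outs (E - {e2} - {e1}) s u + of_bool (s e1 = u)"
      by (rule outs_remove[OF fE'])
    also have "outs (E - {e2} - {e1}) s u = outs (E - {e2} - {e1}) t u"
      by (intro outs_cong) (auto simp: s_def)
    also have "\<dots> = outs (E - {e2}) t u - of_bool (t e1 = u)"
      using outs_remove[OF fE', of t u] by simp
    finally show "outs E s u = outs (E - {e2}) t u + of_bool (u = v)"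
      using te1 unfolding s12 by auto
  next
    fix x assume x: "x \<in> E"
    consider "x = e1" | "x = e2" | "x \<in> E - {e2}" "x \<noteq> e1" "x \<noteq> e2" using x by blast
    then show "s x = a x \<or> s x = b x"
    proof cases
      case 1 then show ?thesis using s12(1) ends1 by (auto simp: doubleton_eq_iff)
    next
      case 2 then show ?thesis using s12(2) ends2 by (auto simp: doubleton_eq_iff)
    next
      case 3
      then show ?thesis using t[OF 3(1)] unfolding s_def by auto
    qed
  qed
qed

section \<open>Orientations with prescribed outdegrees modulo k\<close>

definition mod_orientation ::
  "int \<Rightarrow> 'v set \<Rightarrow> 'e set \<Rightarrow> ('e \<Rightarrow> 'v) \<Rightarrow> ('e \<Rightarrow> 'v) \<Rightarrow> ('v \<Rightarrow> int) \<Rightarrow> ('e \<Rightarrow> 'v) \<Rightarrow> bool" where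
  "mod_orientation k V E a b q t \<longleftrightarrow>
     (\<forall>e\<in>E. t e = a e \<or> t e = b e) \<and> (\<forall>v\<in>V. k dvd outs E t v - q v)"

text \<open>If outdegrees are congruent to \<open>q\<close>, the number \<open>r\<close> of edges that leave \<open>A\<close> is congruent to \<open>sum q A - inside E a b A\<close>.
A set is admissible (for \<open>i = j = 0\<close>) if some \<open>r\<close> of this residue keeps a distance of \<open>k - 1\<close> from the extreme values 0 and
\<open>cut E a b A\<close>, where this distance is relaxed by \<open>dn\<close> and \<open>up\<close>. One may think of \<open>up v\<close> and \<open>dn v\<close> as the numbers of
phantom edges at \<open>v\<close>, which join \<open>v\<close> to a vertex outside and are already oriented into \<open>v\<close> and out of \<open>v\<close>, respectively.
They do not count in \<open>q\<close>, but they arise when the outside of a set is contracted. The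
numbers \<open>i\<close> and \<open>j\<close> measure the slack at the lower and upper bound.\<close>

definition admissible ::
  "int \<Rightarrow> 'e set \<Rightarrow> ('e \<Rightarrow> 'v) \<Rightarrow> ('e \<Rightarrow> 'v) \<Rightarrow> ('v \<Rightarrow> int) \<Rightarrow> ('v \<Rightarrow> int) \<Rightarrow> ('v \<Rightarrow> int) \<Rightarrow>
    int \<Rightarrow> int \<Rightarrow> 'v set \<Rightarrow> bool" where
  "admissible k E a b q up dn i j A \<longleftrightarrow>
     (\<exists>r. k dvd r - (sum q A - inside E a b A) \<and>
          k - 1 - sum dn A + i \<le> r \<and> r \<le> cut E a b A - (k - 1) + sum up A - j)"

text \<open>There may be few phantom edges only. In terms of the outside vertex, with outdegree \<open>x\<close> and indegree \<open>y\<close>, this says that its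
degree is at most \<open>2 * k - 2\<close> plus the least absolute value of a number congruent to \<open>x - y\<close> modulo \<open>2 * k\<close>.\<close>

definition budget :: "int \<Rightarrow> int \<Rightarrow> int \<Rightarrow> bool" where
  "budget k x y \<longleftrightarrow> x \<le> 2 * k - 1 \<and> y \<le> k - 1 \<or> x \<le> k - 1 \<and> y \<le> 2 * k - 1"

text \<open>The prescribed outdegree makes in- and outdegree of \<open>v\<close> equal modulo \<open>2 * k\<close>, phantom edges included, so that all edges at
\<open>v\<close> may be paired up as paths through \<open>v\<close>.\<close>

definition balanced_at ::
  "int \<Rightarrow> 'e set \<Rightarrow> ('e \<Rightarrow> 'v) \<Rightarrow> ('e \<Rightarrow> 'v) \<Rightarrow> ('v \<Rightarrow> int) \<Rightarrow> ('v \<Rightarrow> int) \<Rightarrow> ('v \<Rightarrow> int) \<Rightarrow>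
    'v \<Rightarrow> bool" where
  "balanced_at k E a b q up dn v \<longleftrightarrow>
     (\<exists>c. cut E a b {v} + up v - dn v = 2 * c \<and> k dvd q v - inside E a b {v} - c)"

text \<open>One vertex, the element of \<open>X\<close>, may fail to be admissible if it is balanced. Such a vertex arises when its
edges are lifted pair by pair, which decreases its degree.\<close>

definition feasible ::
  "int \<Rightarrow> 'v set \<Rightarrow> 'e set \<Rightarrow> ('e \<Rightarrow> 'v) \<Rightarrow> ('e \<Rightarrow> 'v) \<Rightarrow> ('v \<Rightarrow> int) \<Rightarrow> ('v \<Rightarrow> int) \<Rightarrow> ('v \<Rightarrow> int) \<Rightarrow>
    'v set \<Rightarrow> bool" where
  "feasible k V E a b q up dn X \<longleftrightarrow>
     2 \<le> k \<and> finite V \<and> V \<noteq> {} \<and> finite E \<and> (\<forall>e\<in>E. a e \<in> V \<and> b e \<in> V) \<and>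
     k dvd sum q V - int (card E) \<and>
     (\<forall>v\<in>V. 0 \<le> up v \<and> 0 \<le> dn v) \<and> budget k (sum up V) (sum dn V) \<and>
     (X = {} \<or> (\<exists>v\<in>V. X = {v} \<and> balanced_at k E a b q up dn v)) \<and>
     (\<forall>A. A \<noteq> {} \<and> A \<subset> V \<and> A \<noteq> X \<longrightarrow> admissible k E a b q up dn 0 0 A)"

lemma feasibleD:
  assumes "feasible k V E a b q up dn X"
  shows "2 \<le> k" "finite V" "V \<noteq> {}" "finite E"
    "\<And>e. e \<in> E \<Longrightarrow> a e \<in> V" "\<And>e. e \<in> E \<Longrightarrow> b e \<in> V"
    "k dvd sum q V - int (card E)"
    "\<And>v. v \<in> V \<Longrightarrow> 0 \<le> up v" "\<And>v. v \<in> V \<Longrightarrow> 0 \<le> dn v"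
    "budget k (sum up V) (sum dn V)"
    "X = {} \<or> (\<exists>v\<in>V. X = {v} \<and> balanced_at k E a b q up dn v)"
    "\<And>A. A \<noteq> {} \<Longrightarrow> A \<subset> V \<Longrightarrow> A \<noteq> X \<Longrightarrow> admissible k E a b q up dn 0 0 A"
  using assms unfolding feasible_def by auto

lemma admissible_mono:
  "admissible k E a b q up dn i j A \<Longrightarrow> i' \<le> i \<Longrightarrow> j' \<le> j \<Longrightarrow> admissible k E a b q up dn i' j' A"
  unfolding admissible_def by force

text \<open>Reversing all edges exchanges the roles of \<open>up\<close> and \<open>dn\<close> and turns the outdegrees \<open>q\<close> into indegrees. This halves the number of
cases below.\<close>

definition mirror :: "'e set \<Rightarrow> ('e \<Rightarrow> 'v) \<Rightarrow> ('e \<Rightarrow> 'v) \<Rightarrow> ('v \<Rightarrow> int) \<Rightarrow> 'v \<Rightarrow> int" where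
  "mirror E a b q v = outs E a v + outs E b v - q v"

lemma sum_mirror:
  assumes "finite A"
  shows "sum (mirror E a b q) A = cut E a b A + 2 * inside E a b A - sum q A"
  unfolding mirror_def using sum_degrees[OF assms, of E a b] by (simp add: sum.distrib sum_subtractf)

lemma mirror_at: "mirror E a b q v = cut E a b {v} + 2 * inside E a b {v} - q v"
  using sum_mirror[of "{v}" E a b q] by simp

lemma mirror_admissible:
  assumes "finite A"
  shows "admissible k E a b (mirror E a b q) dn up j i A = admissible k E a b q up dn i j A"
proof
  assume "admissible k E a b q up dn i j A"
  then obtain r where r: "k dvd r - (sum q A - inside E a b A)"
     "k - 1 - sum dn A + i \<le> r" "r \<le> cut E a b A - (k - 1) + sum up A - j"
    unfolding admissible_def by blast
  show "admissible k E a b (mirror E a b q) dn up j i A"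
    unfolding admissible_def sum_mirror[OF assms]
  proof (intro exI[of _ "cut E a b A - r"] conjI)
    show "k dvd cut E a b A - r - (cut E a b A + 2 * inside E a b A - sum q A - inside E a b A)"
      by (rule dvd_subst[OF dvd_minus_iff[THEN iffD2, OF r(1)]]) simp
  qed (use r in linarith)+
next
  assume "admissible k E a b (mirror E a b q) dn up j i A"
  then obtain r where r: "k dvd r - (cut E a b A + 2 * inside E a b A - sum q A - inside E a b A)"
     "k - 1 - sum up A + j \<le> r" "r \<le> cut E a b A - (k - 1) + sum dn A - i"
    unfolding admissible_def sum_mirror[OF assms] by blast
  show "admissible k E a b q up dn i j A"
    unfolding admissible_def
  proof (intro exI[of _ "cut E a b A - r"] conjI)
    show "k dvd cut E a b A - r - (sum q A - inside E a b A)"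
      by (rule dvd_subst[OF dvd_minus_iff[THEN iffD2, OF r(1)]]) simp
  qed (use r in linarith)+
qed

lemma mirror_balanced:
  assumes "balanced_at k E a b q up dn v"
  shows "balanced_at k E a b (mirror E a b q) dn up v"
proof -
  obtain c where c: "cut E a b {v} + up v - dn v = 2 * c" "k dvd q v - inside E a b {v} - c"
    using assms unfolding balanced_at_def by blast
  show ?thesis unfolding balanced_at_def mirror_at
  proof (intro exI[of _ "cut E a b {v} - c"] conjI)
    show "cut E a b {v} + dn v - up v = 2 * (cut E a b {v} - c)" using c(1) by (simp add: algebra_simps)
    show "k dvd cut E a b {v} + 2 * inside E a b {v} - q v - inside E a b {v} - (cut E a b {v} - c)"
      by (rule dvd_subst[OF dvd_minus_iff[THEN iffD2, OF c(2)]]) simp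
  qed
qed

lemma mirror_feasible:
  assumes "feasible k V E a b q up dn X"
  shows "feasible k V E a b (mirror E a b q) dn up X"
proof -
  note D = feasibleD[OF assms]
  note fin = D(2,4) and ends = D(5,6) and tot = D(7)
  have i: "inside E a b V = int (card E)" unfolding inside_def using ends by simp
  have c: "cut E a b V = 0" unfolding cut_def using ends by (intro sum.neutral) auto
  have t: "k dvd sum (mirror E a b q) V - int (card E)"
    unfolding sum_mirror[OF fin(1)] i c
    by (rule dvd_subst[OF dvd_minus_iff[THEN iffD2, OF tot]]) simp
  have s: "admissible k E a b (mirror E a b q) dn up 0 0 A" if "A \<noteq> {}" "A \<subset> V" "A \<noteq> X" for A
  proof -
    have "admissible k E a b q up dn 0 0 A" using D(12) that by simp
    moreover have "finite A" using that fin finite_subset by blast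
    ultimately show ?thesis using mirror_admissible by blast
  qed
  have B: "budget k (sum dn V) (sum up V)" using D(10) unfolding budget_def by linarith
  have x: "X = {} \<or> (\<exists>v\<in>V. X = {v} \<and> balanced_at k E a b (mirror E a b q) dn up v)"
    using D(11) by (auto intro: mirror_balanced)
  show ?thesis unfolding feasible_def
    using D(1-6,8,9) t s B x by (intro conjI ballI allI impI) simp_all
qed

lemma mirror_orientation:
  assumes "mod_orientation k V E a b (mirror E a b q) t"
  shows "\<exists>h. mod_orientation k V E a b q h"
proof -
  define h where "h = (\<lambda>e. if t e = a e then b e else a e)"
  have te: "t e = a e \<or> t e = b e" if "e \<in> E" for e
    using assms that unfolding mod_orientation_def by blast
  have o: "outs E t v + outs E h v = outs E a v + outs E b v" for v
    unfolding h_def using te by (rule outs_reorient)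
  have "mod_orientation k V E a b q h"
    unfolding mod_orientation_def
  proof (intro conjI ballI)
    show "h e = a e \<or> h e = b e" for e unfolding h_def by auto
  next
    fix v assume "v \<in> V"
    then have "k dvd outs E t v - mirror E a b q v" using assms unfolding mod_orientation_def by blast
    then have "k dvd - (outs E t v - mirror E a b q v)" by (simp only: dvd_minus_iff)
    then show "k dvd outs E h v - q v"
      by (rule dvd_subst) (use o[of v] in \<open>simp add: mirror_def\<close>)
  qed
  then show ?thesis by blast
qed

text \<open>The induction is on the number of vertices, then of edges, then of phantom edges. In a least counterexample, first,
every proper set with at least two vertices is admissible with slack 1 on both sides: otherwise orient first the graph in which it is
contracted and then its inside. With this slack, one edge can be oriented and deleted, or two edges can be lifted,
without harm to such sets, and only single vertices have to be watched. Balanced vertices can be lifted away. At any other vertex there is slack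
on one side, so it can afford to lose an out-edge or to lose an in-edge. An edge from
a vertex of the first kind to one of the second kind could be oriented and deleted, hence by connectedness all vertices are
of the same kind, say the first. Phantom edges out of vertices of this kind can be dropped. So there are none, and the budget
leaves room for \<open>k - 1\<close> of them; with these at one vertex \<open>w\<close>, the latter can afford to lose an in-edge too.\<close>

locale least_counterexample =
  fixes k :: int and V :: "'v set" and E :: "'e set" and a b :: "'e \<Rightarrow> 'v"
    and q up dn :: "'v \<Rightarrow> int" and X :: "'v set"
  assumes feas: "feasible k V E a b q up dn X"
    and none: "\<nexists>t. mod_orientation k V E a b q t"
    and least: "\<And>V' E' a' b' q' up' dn' X'.
      feasible k V' E' a' b' q' up' dn' X' \<Longrightarrow>
      ((card V', card E', nat (sum up' V' + sum dn' V')), (card V, card E, nat (sum up V + sum dn V)))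
         \<in> less_than <*lex*> less_than <*lex*> less_than \<Longrightarrow>
      \<exists>t. mod_orientation k (V' :: 'v set) (E' :: 'e set) a' b' q' t"

begin

lemmas k2 = feasibleD(1)[OF feas] and finV = feasibleD(2)[OF feas] and neV = feasibleD(3)[OF feas]
  and finE = feasibleD(4)[OF feas] and endsV = feasibleD(5,6)[OF feas] and total = feasibleD(7)[OF feas]
  and nonneg = feasibleD(8,9)[OF feas] and budg = feasibleD(10)[OF feas]
  and Xcase = feasibleD(11)[OF feas] and admissibleA = feasibleD(12)[OF feas]

lemma cardE_remove: "e0 \<in> E \<Longrightarrow> int (card (E - {e0})) = int (card E) - 1"
  using finE by (metis One_nat_def Suc_pred card_Diff_singleton card_gt_0_iff empty_iff of_nat_1 of_nat_diff Suc_leI)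

lemma extend_by_edge:
  assumes e0: "e0 \<in> E" "x = a e0 \<or> x = b e0"
    and fe: "feasible k V (E - {e0}) a b (q(x := q x - 1)) up' dn' X'"
  shows False
proof -
  have "card (E - {e0}) < card E" using e0 finE by (meson card_Diff1_less)
  then obtain t where t: "mod_orientation k V (E - {e0}) a b (q(x := q x - 1)) t"
    using least[OF fe] by auto
  have "mod_orientation k V E a b q (t(e0 := x))"
    unfolding mod_orientation_def
  proof (intro conjI ballI)
    fix e assume "e \<in> E"
    then show "(t(e0 := x)) e = a e \<or> (t(e0 := x)) e = b e"
      using t e0 unfolding mod_orientation_def by auto
  next
    fix v assume v: "v \<in> V"
    have "outs (E - {e0}) (t(e0 := x)) v = outs (E - {e0}) t v" by (intro outs_cong) auto
    then have "outs E (t(e0 := x)) v = outs (E - {e0}) t v + of_bool (x = v)"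
      using outs_remove[OF finE e0(1), of "t(e0 := x)" v] by simp
    moreover have "k dvd outs (E - {e0}) t v - (q(x := q x - 1)) v"
      using t v unfolding mod_orientation_def by auto
    ultimately show "k dvd outs E (t(e0 := x)) v - q v" 
      by (cases "x = v") (auto simp: algebra_simps)
  qed
  then show False using none by blast
qed

lemma crossing_edge:
  assumes "1 \<le> cut E a b A"
  obtains e x y where "e \<in> E" "{a e, b e} = {x, y}" "x \<in> A" "y \<notin> A"
proof -
  have "\<exists>e\<in>E. (a e \<in> A) \<noteq> (b e \<in> A)"
  proof (rule ccontr)
    assume "\<not> ?thesis"
    then have "cut E a b A = 0" unfolding cut_def by (intro sum.neutral) auto
    then show False using assms by simp
  qed
  then obtain e where e: "e \<in> E" "(a e \<in> A) \<noteq> (b e \<in> A)" by blast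
  show thesis
  proof (cases "a e \<in> A")
    case True then show ?thesis using e that[of e "a e" "b e"] by auto
  next
    case False then show ?thesis using e that[of e "b e" "a e"] by auto
  qed
qed

lemma singleton_proper:
  assumes "v \<in> V"
  shows "{v} \<subset> V"
proof (rule ccontr)
  assume "\<not> ?thesis"
  then have V: "V = {v}" using assms by auto
  then have "a e = v" if "e \<in> E" for e using endsV[OF that] by simp
  then have "outs E a v = int (card E)" unfolding outs_def by simp
  moreover have "k dvd - (sum q V - int (card E))" using total by (simp only: dvd_minus_iff)
  then have "k dvd int (card E) - q v" by (rule dvd_subst) (simp add: V)
  ultimately have "mod_orientation k V E a b q a"
    unfolding mod_orientation_def V by simp
  then show False using none by blast
qed

lemma single_or_big:
  assumes "A \<noteq> {}" "A \<subset> V"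
  obtains z where "A = {z}" | "2 \<le> card A"
proof (cases "2 \<le> card A")
  case False
  have "finite A" using assms finV finite_subset by blast
  then have "card A \<noteq> 0" using assms by simp
  then have "card A = 1" using False by linarith
  then show ?thesis using that by (auto simp: card_1_singleton_iff)
qed

lemma mirrored: "least_counterexample k V E a b (mirror E a b q) dn up X"
proof
  show "feasible k V E a b (mirror E a b q) dn up X" using feas by (rule mirror_feasible)
  show "\<nexists>t. mod_orientation k V E a b (mirror E a b q) t" using none mirror_orientation by blast
next
  fix V' :: "'v set" and E' :: "'e set" and a' b' q' up' dn' X'
  assume "feasible k V' E' a' b' q' up' dn' X'"
   "((card V', card E', nat (sum up' V' + sum dn' V')), card V, card E, nat (sum dn V + sum up V))
         \<in> less_than <*lex*> less_than <*lex*> less_than"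
  then show "\<exists>t. mod_orientation k V' E' a' b' q' t" using least by (simp add: add.commute)
qed

text \<open>An orientation of the graph in which \<open>A\<close> is contracted, read as an orientation \<open>t\<close> of the original edges. It settles the vertices
outside of \<open>A\<close>, whereas inside \<open>A\<close> only the total outdegree is right.\<close>

lemma contraction:
  assumes A: "A \<subseteq> V" "2 \<le> card A"
  obtains t where "\<And>e. e \<in> E \<Longrightarrow> t e = a e \<or> t e = b e"
    "\<And>v. v \<in> V - A \<Longrightarrow> k dvd outs E t v - q v"
    "k dvd sum (outs E t) A - sum q A"
proof -
  have finA: "finite A" using A finV finite_subset by blast
  obtain c where c: "c \<in> A" using A(2) by fastforce
  \<comment> \<open>The set \<open>A\<close> is shrunk to its element \<open>c\<close>; the subsets \<open>B\<close> of the smaller vertex set \<open>W\<close> correspond to the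
    subsets \<open>pre B\<close> of \<open>V\<close> that contain all of \<open>A\<close> or nothing of it, and cuts are the same.\<close>
  define \<phi> where "\<phi> x = (if x \<in> A then c else x)" for x
  define W where "W = insert c (V - A)"
  define m where "m f y = (if y = c then sum f A else f y)" for f :: "'v \<Rightarrow> int" and y
  define pre where "pre B = (if c \<in> B then B \<union> A else B)" for B
  have preV: "pre B \<subseteq> V" if "B \<subseteq> W" for B
    using that A c unfolding pre_def W_def by auto
  have mem: "(\<phi> x \<in> B) = (x \<in> pre B)" if "B \<subseteq> W" "x \<in> V" for x B
    using that c unfolding pre_def W_def \<phi>_def by auto
  have summ: "sum (m f) B = sum f (pre B)" if "B \<subseteq> W" for B f
  proof (cases "c \<in> B")
    case True
    have "finite B" using that finV finite_subset unfolding W_def by auto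
    then have "sum (m f) B = m f c + sum (m f) (B - {c})" using True by (rule sum.remove)
    also have "sum (m f) (B - {c}) = sum f (B - {c})"
      by (intro sum.cong) (auto simp: m_def)
    also have "m f c + sum f (B - {c}) = sum f (A \<union> (B - {c}))"
      using that \<open>finite B\<close> finA unfolding m_def W_def
      by (subst sum.union_disjoint) auto
    also have "A \<union> (B - {c}) = pre B" using True c unfolding pre_def by auto
    finally show ?thesis .
  next
    case False
    then show ?thesis unfolding pre_def m_def by (auto intro!: sum.cong)
  qed
  have preW: "pre W = V" using A c unfolding pre_def W_def by auto
  have cutm: "cut E (\<phi> \<circ> a) (\<phi> \<circ> b) B = cut E a b (pre B)" if "B \<subseteq> W" for B
    unfolding cut_def using mem[OF that] endsV by (intro sum.cong) auto
  have insm: "inside E (\<phi> \<circ> a) (\<phi> \<circ> b) B = inside E a b (pre B)" if "B \<subseteq> W" for B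
    unfolding inside_def using mem[OF that] endsV by (intro sum.cong) auto
  \<comment> \<open>An exceptional vertex in \<open>A\<close> is absorbed, as the contracted vertex inherits admissibility from \<open>A\<close>.\<close>
  define Y where "Y = (if X \<subseteq> A then {} else X)"
  have "feasible k W E (\<phi> \<circ> a) (\<phi> \<circ> b) (m q) (m up) (m dn) Y"
    unfolding feasible_def
  proof (intro conjI ballI allI impI)
    show "Y = {} \<or> (\<exists>v\<in>W. Y = {v} \<and> balanced_at k E (\<phi> \<circ> a) (\<phi> \<circ> b) (m q) (m up) (m dn) v)"
    proof (cases "X \<subseteq> A")
      case False
      then obtain v where v: "v \<in> V" "X = {v}" "v \<notin> A" "balanced_at k E a b q up dn v"
        using Xcase by auto
      then have "pre {v} = {v}" "{v} \<subseteq> W" "v \<noteq> c" using c unfolding pre_def W_def by auto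
      then have "balanced_at k E (\<phi> \<circ> a) (\<phi> \<circ> b) (m q) (m up) (m dn) v"
        using v(4) cutm[of "{v}"] insm[of "{v}"] unfolding balanced_at_def m_def by simp
      then show ?thesis using v False \<open>{v} \<subseteq> W\<close> unfolding Y_def by auto
    qed (simp add: Y_def)
  next
    fix B assume B: "B \<noteq> {} \<and> B \<subset> W \<and> B \<noteq> Y"
    then have BW: "B \<subseteq> W" by auto
    have "pre B \<noteq> V"
    proof
      assume "pre B = V"
      then have "c \<in> B" using c A by (auto simp: pre_def split: if_splits)
      then have "W \<subseteq> B" using \<open>pre B = V\<close> unfolding W_def pre_def by auto
      then show False using B by auto
    qed
    moreover have "pre B \<noteq> X"
    proof
      assume eq: "pre B = X"
      have "pre B \<noteq> {}" using B c unfolding pre_def by auto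
      then obtain v where v: "X = {v}" using Xcase eq by auto
      have "c \<notin> B"
      proof
        assume "c \<in> B"
        then have "A \<subseteq> {v}" using eq v unfolding pre_def by auto
        then have "card A \<le> 1" using card_mono[of "{v}" A] by auto
        then show False using A(2) by simp
      qed
      then have "B = {v}" "v \<notin> A" using eq v BW unfolding pre_def W_def by auto
      then show False using B v unfolding Y_def by auto
    qed
    moreover have "pre B \<noteq> {}" using B c unfolding pre_def by auto
    ultimately have "admissible k E a b q up dn 0 0 (pre B)"
      using admissibleA[of "pre B"] preV[OF BW] by auto
    then show "admissible k E (\<phi> \<circ> a) (\<phi> \<circ> b) (m q) (m up) (m dn) 0 0 B"
      unfolding admissible_def cutm[OF BW] insm[OF BW] summ[OF BW] .
  next
    show "k dvd sum (m q) W - int (card E)" using total summ[of W q] preW by simp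
    show "budget k (sum (m up) W) (sum (m dn) W)" using budg summ[of W] preW by simp
  next
    fix v assume "v \<in> W"
    then show "0 \<le> m up v" "0 \<le> m dn v" using nonneg A unfolding m_def W_def
      by (auto intro!: sum_nonneg)
  qed (use k2 finV finE endsV A c in \<open>auto simp: W_def \<phi>_def\<close>)
  moreover have "card W < card V"
  proof -
    have "card W = card (V - A) + 1" using finV c unfolding W_def by simp
    also have "\<dots> = card V - card A + 1" using A finA by (simp add: card_Diff_subset)
    finally show ?thesis using A card_mono[OF finV A(1)] by linarith
  qed
  ultimately obtain t where t: "mod_orientation k W E (\<phi> \<circ> a) (\<phi> \<circ> b) (m q) t"
    using least by force
  define s where "s e = (if t e = \<phi> (a e) then a e else b e)" for e
  have ps: "\<phi> (s e) = t e" if "e \<in> E" for e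
    using t that unfolding mod_orientation_def s_def by auto
  have sV: "s e \<in> V" if "e \<in> E" for e using endsV that unfolding s_def by auto
  show thesis
  proof (rule that)
    show "s e = a e \<or> s e = b e" for e unfolding s_def by auto
  next
    fix v assume v: "v \<in> V - A"
    have "(s e = v) = (t e = v)" if "e \<in> E" for e
      using ps[OF that] v c unfolding \<phi>_def by (cases "s e \<in> A") auto
    then have "outs E s v = outs E t v" unfolding outs_def by (intro sum.cong) auto
    moreover have "k dvd outs E t v - m q v" using t v unfolding mod_orientation_def W_def by auto
    moreover have "v \<noteq> c" using v c by auto
    ultimately show "k dvd outs E s v - q v" unfolding m_def by simp
  next
    have "sum (outs E s) A = (\<Sum>e\<in>E. of_bool (s e \<in> A))" using finA by (rule sum_outs)
    also have "\<dots> = outs E t c" unfolding outs_def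
    proof (intro sum.cong refl)
      fix e assume "e \<in> E"
      from ps[OF this] show "of_bool (s e \<in> A) = (of_bool (t e = c) :: int)"
        using c unfolding \<phi>_def by (cases "s e \<in> A") auto
    qed
    finally have "sum (outs E s) A = outs E t c" .
    moreover have "k dvd outs E t c - m q c" using t unfolding mod_orientation_def W_def by auto
    ultimately show "k dvd sum (outs E s) A - sum q A" unfolding m_def by simp
  qed
qed

text \<open>Edges inside \<open>A\<close> may be oriented anew, by a map \<open>s\<close>, without any effect outside.\<close>

lemma glue:
  assumes tc: "\<And>e. e \<in> E \<Longrightarrow> t e = a e \<or> t e = b e"
    "\<And>v. v \<in> V - A \<Longrightarrow> k dvd outs E t v - q v"
    and EA: "EA = {e \<in> E. a e \<in> A \<and> b e \<in> A}"
    and s: "\<And>e. e \<in> EA \<Longrightarrow> s e = a e \<or> s e = b e"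
    "\<And>v. v \<in> A \<Longrightarrow> k dvd outs EA s v + outs (E - EA) t v - q v"
  shows False
proof -
  define u where "u e = (if e \<in> EA then s e else t e)" for e
  have sub: "EA \<subseteq> E" using EA by auto
  have split: "outs E u v = outs EA s v + outs (E - EA) t v" for v
  proof -
    have "outs E u v = outs EA u v + outs (E - EA) u v" by (rule outs_split[OF finE sub])
    moreover have "outs EA u v = outs EA s v" by (intro outs_cong) (auto simp: u_def)
    moreover have "outs (E - EA) u v = outs (E - EA) t v" by (intro outs_cong) (auto simp: u_def)
    ultimately show ?thesis by simp
  qed
  have "mod_orientation k V E a b q u"
    unfolding mod_orientation_def
  proof (intro conjI ballI)
    fix e assume "e \<in> E" then show "u e = a e \<or> u e = b e" using tc s unfolding u_def by auto
  next
    fix v assume v: "v \<in> V"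
    show "k dvd outs E u v - q v"
    proof (cases "v \<in> A")
      case True then show ?thesis using s(2) split by simp
    next
      case False
      have "s e \<noteq> v \<and> t e \<noteq> v" if "e \<in> EA" for e
        using that s(1)[OF that] tc(1)[of e] False unfolding EA by auto
      then have "outs EA s v = 0" "outs EA t v = 0"
        unfolding outs_def by (auto intro!: sum.neutral)
      then have "outs E u v = outs E t v" using split outs_split[OF finE sub, of t v] by simp
      then show ?thesis using tc(2) v False by simp
    qed
  qed
  then show False using none by blast
qed

text \<open>If the slack is missing, the interval of admissible numbers has length at most \<open>k\<close> and the residue is at one of its ends. Then, whatever
orientation the contraction yields, the edges that leave \<open>A\<close> satisfy the budget as phantom edges for the inside of \<open>A\<close>, and
minimality applies there as well.\<close>

lemma strictly_admissible:
  assumes A: "A \<subset> V" "2 \<le> card A"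
  shows "admissible k E a b q up dn 1 1 A"
proof (rule ccontr)
  assume no: "\<not> admissible k E a b q up dn 1 1 A"
  have AV: "A \<subseteq> V" using A by auto
  have finA: "finite A" using AV finV finite_subset by blast
  have "A \<noteq> X" using Xcase A(2) by auto
  moreover have "A \<noteq> {}" using A(2) by auto
  ultimately have s0: "admissible k E a b q up dn 0 0 A" using admissibleA A by blast
  obtain t where t: "\<And>e. e \<in> E \<Longrightarrow> t e = a e \<or> t e = b e"
    "\<And>v. v \<in> V - A \<Longrightarrow> k dvd outs E t v - q v"
    "k dvd sum (outs E t) A - sum q A"
    using contraction[OF AV A(2)] by blast
  define EA where "EA = {e \<in> E. a e \<in> A \<and> b e \<in> A}"
  have sub: "EA \<subseteq> E" unfolding EA_def by auto
  define h where "h e = (if t e = a e then b e else a e)" for e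
  \<comment> \<open>Once the edges that leave \<open>A\<close> are oriented, \<open>ct\<close> of them leave \<open>v\<close> and \<open>ch\<close> of them enter \<open>v\<close>; inside \<open>A\<close>
    they become phantom edges.\<close>
  define ct where "ct = outs (E - EA) t"
  define ch where "ch = outs (E - EA) h"
  have cut_split: "cut E a b B = cut EA a b B + sum ct B + sum ch B" if "B \<subseteq> A" for B
  proof -
    have fB: "finite B" using that finA finite_subset by blast
    have "cut E a b B = cut (E - EA) a b B + cut EA a b B"
      unfolding cut_def using sum.subset_diff[OF sub finE] by simp
    also have "cut (E - EA) a b B = (\<Sum>e\<in>E - EA. of_bool (t e \<in> B) + of_bool (h e \<in> B))"
      unfolding cut_def
    proof (intro sum.cong refl)
      fix e assume "e \<in> E - EA"
      then have "\<not> (a e \<in> B \<and> b e \<in> B)" "t e = a e \<or> t e = b e"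
        using that t(1) unfolding EA_def by auto
      then show "of_bool ((a e \<in> B) \<noteq> (b e \<in> B)) = (of_bool (t e \<in> B) + of_bool (h e \<in> B) :: int)"
        unfolding h_def by auto
    qed
    also have "\<dots> = sum ct B + sum ch B"
      unfolding ct_def ch_def sum_outs[OF fB] by (rule sum.distrib)
    finally show ?thesis by simp
  qed
  have inside_eq: "inside E a b B = inside EA a b B" if "B \<subseteq> A" for B
    unfolding inside_def using finE sub that by (intro sum.mono_neutral_right) (auto simp: EA_def)
  have insA: "inside EA a b A = int (card EA)" unfolding inside_def EA_def by simp
  have cutA: "cut EA a b A = 0" unfolding cut_def EA_def by (intro sum.neutral) auto
  have ct0: "0 \<le> ct v" "0 \<le> ch v" for v unfolding ct_def ch_def outs_def by (auto intro!: sum_nonneg)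
  define r0 where "r0 = sum ct A"
  have r0: "0 \<le> r0" "0 \<le> sum ch A" unfolding r0_def using ct0 by (auto intro!: sum_nonneg)
  have cutEA: "cut E a b A = r0 + sum ch A" using cut_split[of A] cutA r0_def by simp
  have "sum (outs E t) A = sum (outs EA t) A + r0"
    unfolding r0_def ct_def sum.distrib[symmetric] by (intro sum.cong refl outs_split[OF finE sub])
  also have "sum (outs EA t) A = int (card EA)"
  proof -
    have "t e \<in> A" if "e \<in> EA" for e using that t(1)[of e] unfolding EA_def by auto
    then show ?thesis unfolding sum_outs[OF finA] by simp
  qed
  finally have r0dvd: "k dvd r0 - (sum q A - inside E a b A)"
    using t(3) inside_eq[of A] insA by (simp add: algebra_simps)
  define Y where "Y = (if X \<subseteq> A then X else {})"
  have bal: "budget k (sum up A + sum ch A) (sum dn A + r0)"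
  proof -
    define lo where "lo = k - 1 - sum dn A"
    define hi where "hi = cut E a b A - (k - 1) + sum up A"
    obtain r where r: "k dvd r - (sum q A - inside E a b A)" "lo \<le> r" "r \<le> hi"
      using s0 unfolding admissible_def lo_def hi_def by auto
    have no': "\<not> (lo + 1 \<le> x \<and> x \<le> hi - 1)" if "k dvd x - (sum q A - inside E a b A)" for x
      using no that unfolding admissible_def lo_def hi_def by auto
    have d1: "k dvd (r + k) - (sum q A - inside E a b A)" 
      using dvd_add[OF r(1) dvd_refl[of k]] by (simp add: algebra_simps)
    have d2: "k dvd (r - k) - (sum q A - inside E a b A)" 
      using dvd_diff[OF r(1) dvd_refl[of k]] by (simp add: algebra_simps)
    \<comment> \<open>No residue lies strictly between the bounds, so the admissible number is one of them.\<close>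
    have ends: "r = lo \<or> r = hi" using no'[OF r(1)] r by linarith
    have len: "hi - lo \<le> k" using ends no'[OF d1] no'[OF d2] k2 by linarith
    have "k dvd r0 - r" using dvd_diff[OF r0dvd r(1)] by (simp add: algebra_simps)
    then obtain j where j: "r0 = r + k * j" by (metis add.commute diff_add_cancel dvdE)
    have u: "0 \<le> sum up A" "0 \<le> sum dn A" using nonneg AV by (auto intro!: sum_nonneg)
    have jle: "k * j \<le> k * x" if "j \<le> x" for x using k2 that by (intro mult_left_mono) auto
    have jge: "k * x \<le> k * j" if "x \<le> j" for x using k2 that by (intro mult_left_mono) auto
    \<comment> \<open>The number \<open>r0\<close> of edges leaving \<open>A\<close> differs from that bound by \<open>k * j\<close>, and only two values of \<open>j\<close> keep the
      in- and outdegrees of the contracted outside nonnegative; they give the two alternatives of the budget.\<close>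
    from ends show ?thesis
    proof
      assume rl: "r = lo"
      have dn: "sum dn A + r0 = k - 1 + k * j" using j rl unfolding lo_def hi_def by linarith
      have upp: "sum up A + sum ch A = hi - lo + k - 1 - k * j" 
        using j rl cutEA unfolding lo_def hi_def by linarith
      have "\<not> j \<le> -1" using jle[of "-1"] dn u(2) r0(1) by linarith
      moreover have "\<not> j \<ge> 2" using jge[of 2] upp u(1) r0(2) len k2 by linarith
      ultimately have "j = 0 \<or> j = 1" by linarith
      then show ?thesis unfolding budget_def dn upp using len k2 r(3) rl by auto
    next
      assume rl: "r = hi"
      have upp: "sum up A + sum ch A = k - 1 - k * j" 
        using j rl cutEA unfolding hi_def by linarith
      have dn: "sum dn A + r0 = hi - lo + k - 1 + k * j" using j rl unfolding lo_def hi_def by linarith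
      have "\<not> j \<ge> 1" using jge[of 1] upp u(1) r0(2) by linarith
      moreover have "\<not> j \<le> -2" using jle[of "-2"] dn u(2) r0(1) len k2 by linarith
      ultimately have "j = 0 \<or> j = -1" by linarith
      then show ?thesis unfolding budget_def dn upp using len k2 r(2) rl by auto
    qed
  qed
  have "feasible k A EA a b (\<lambda>v. q v - ct v) (\<lambda>v. up v + ch v) (\<lambda>v. dn v + ct v) Y"
    unfolding feasible_def
  proof (intro conjI ballI allI impI)
    have "sum (\<lambda>v. q v - ct v) A = sum q A - r0" unfolding r0_def by (rule sum_subtractf)
    then have "sum (\<lambda>v. q v - ct v) A - int (card EA) = - (r0 - (sum q A - inside E a b A))"
      using inside_eq[of A] insA by simp
    then show "k dvd sum (\<lambda>v. q v - ct v) A - int (card EA)" using r0dvd by (simp only: dvd_minus_iff)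
  next
    show "budget k (\<Sum>v\<in>A. up v + ch v) (\<Sum>v\<in>A. dn v + ct v)"
      using bal by (simp add: sum.distrib r0_def)
  next
    show "Y = {} \<or> (\<exists>v\<in>A. Y = {v} \<and> balanced_at k EA a b (\<lambda>v. q v - ct v)
       (\<lambda>v. up v + ch v) (\<lambda>v. dn v + ct v) v)"
    proof (cases "X \<subseteq> A \<and> X \<noteq> {}")
      case True
      then obtain v where v: "v \<in> A" "X = {v}" "balanced_at k E a b q up dn v"
        using Xcase by auto
      obtain c where c: "cut E a b {v} + up v - dn v = 2 * c" "k dvd q v - inside E a b {v} - c"
        using v(3) unfolding balanced_at_def by blast
      have vA: "{v} \<subseteq> A" using v(1) by simp
      have "balanced_at k EA a b (\<lambda>v. q v - ct v) (\<lambda>v. up v + ch v) (\<lambda>v. dn v + ct v) v"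
        unfolding balanced_at_def
      proof (intro exI[of _ "c - ct v"] conjI)
        show "cut EA a b {v} + (up v + ch v) - (dn v + ct v) = 2 * (c - ct v)"
          using c(1) cut_split[OF vA] by simp
        show "k dvd q v - ct v - inside EA a b {v} - (c - ct v)"
          by (rule dvd_subst[OF c(2)]) (simp add: inside_eq[OF vA])
      qed
      then show ?thesis using v True unfolding Y_def by auto
    qed (auto simp: Y_def)
  next
    fix B assume B: "B \<noteq> {} \<and> B \<subset> A \<and> B \<noteq> Y"
    then have BA: "B \<subseteq> A" by auto
    have "B \<noteq> X" using B BA unfolding Y_def by (cases "X \<subseteq> A") simp_all
    moreover have "B \<noteq> {}" "B \<subset> V" using B AV by blast+
    ultimately have "admissible k E a b q up dn 0 0 B" using admissibleA by simp
    then obtain r where r: "k dvd r - (sum q B - inside E a b B)" "k - 1 - sum dn B \<le> r" 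
       "r \<le> cut E a b B - (k - 1) + sum up B"
      unfolding admissible_def by auto
    show "admissible k EA a b (\<lambda>v. q v - ct v) (\<lambda>v. up v + ch v) (\<lambda>v. dn v + ct v) 0 0 B"
      unfolding admissible_def sum.distrib sum_subtractf
    proof (intro exI[of _ "r - sum ct B"] conjI)
      show "k dvd r - sum ct B - (sum q B - sum ct B - inside EA a b B)"
        by (rule dvd_subst[OF r(1)]) (simp add: inside_eq[OF BA])
      show "k - 1 - (sum dn B + sum ct B) + 0 \<le> r - sum ct B" using r(2) by linarith
      show "r - sum ct B \<le> cut EA a b B - (k - 1) + (sum up B + sum ch B) - 0"
        using r(3) cut_split[OF BA] by linarith
    qed
  next
    fix v assume "v \<in> A" then show "0 \<le> up v + ch v" "0 \<le> dn v + ct v"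
      using nonneg ct0 AV by (auto intro!: add_nonneg_nonneg)
  qed (use k2 finA finE A(2) in \<open>auto simp: EA_def\<close>)
  moreover have "card A < card V" using A finV psubset_card_mono by blast
  ultimately obtain s where s: "mod_orientation k A EA a b (\<lambda>v. q v - ct v) s" using least by force
  show False
  proof (rule glue[OF t(1,2) EA_def])
    show "s e = a e \<or> s e = b e" if "e \<in> EA" for e using s that unfolding mod_orientation_def by auto
    show "k dvd outs EA s v + outs (E - EA) t v - q v" if "v \<in> A" for v
      using s that unfolding mod_orientation_def ct_def by (auto simp: algebra_simps)
  qed
qed

text \<open>An edge from \<open>x\<close> to \<open>y\<close> uses up slack at the lower bound for sets that contain \<open>x\<close> but not \<open>y\<close>, and at the upper bound
for sets that contain \<open>y\<close> but not \<open>x\<close>. Phantom edges \<open>dn'\<close> may be added for this purpose within the budget.\<close>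

lemma orient_edge:
  assumes e0: "e0 \<in> E" "{a e0, b e0} = {x, y}" "x \<noteq> y"
    and big: "\<And>A. A \<subset> V \<Longrightarrow> 2 \<le> card A \<Longrightarrow> admissible k E a b q up dn 1 1 A"
    and X0: "X = {}"
    and more: "\<And>v. v \<in> V \<Longrightarrow> dn v \<le> dn' v" 
    and bud: "budget k (sum up V) (sum dn' V)"
    and sx: "admissible k E a b q up dn' 1 0 {x}"
    and sy: "admissible k E a b q up dn' 0 1 {y}"
  shows False
proof -
  have xV: "x \<in> V" "y \<in> V" using e0 endsV by (auto simp: doubleton_eq_iff)
  have "feasible k V (E - {e0}) a b (q(x := q x - 1)) up dn' {}"
    unfolding feasible_def
  proof (intro conjI ballI allI impI)
    have "sum (q(x := q x - 1)) V = sum q V - 1" using xV sum_fun_upd_int[OF finV, of q x "q x - 1"] by simp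
    then show "k dvd sum (q(x := q x - 1)) V - int (card (E - {e0}))"
      using total cardE_remove[OF e0(1)] by simp
  next
    fix A assume A: "A \<noteq> {} \<and> A \<subset> V \<and> A \<noteq> {}"
    then have fA: "finite A" using finV finite_subset by blast
    have s: "admissible k E a b q up dn' (of_bool (x \<in> A \<and> y \<notin> A)) (of_bool (y \<in> A \<and> x \<notin> A)) A"
    proof (cases "2 \<le> card A")
      case True
      then have "admissible k E a b q up dn 1 1 A" using big A by blast
      moreover have "sum dn A \<le> sum dn' A" using more A by (intro sum_mono) auto
      ultimately have "admissible k E a b q up dn' 1 1 A" unfolding admissible_def by force
      then show ?thesis by (rule admissible_mono) auto
    next
      case False
      then have "card A = 1" using A fA
        by (metis One_nat_def card_0_eq less_2_cases not_le)
      then obtain z where z: "A = {z}" by (auto simp: card_1_singleton_iff)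
      have "z \<noteq> x \<Longrightarrow> z \<noteq> y \<Longrightarrow> admissible k E a b q up dn 0 0 A" using admissibleA[of A] A X0 by auto
      moreover have "sum dn A \<le> sum dn' A" using more A by (intro sum_mono) auto
      ultimately have "z \<noteq> x \<Longrightarrow> z \<noteq> y \<Longrightarrow> admissible k E a b q up dn' 0 0 A" 
        unfolding admissible_def by force
      then show ?thesis using sx sy e0(3) z by (cases "z = x"; cases "z = y") auto
    qed
    have ends: "a e0 = x \<and> b e0 = y \<or> a e0 = y \<and> b e0 = x" using e0 by (auto simp: doubleton_eq_iff)
    obtain r where r: "k dvd r - (sum q A - inside E a b A)"
       "k - 1 - sum dn' A + of_bool (x \<in> A \<and> y \<notin> A) \<le> r" 
       "r \<le> cut E a b A - (k - 1) + sum up A - of_bool (y \<in> A \<and> x \<notin> A)"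
      using s unfolding admissible_def by blast
    have c: "cut (E - {e0}) a b A = cut E a b A - of_bool ((x \<in> A) \<noteq> (y \<in> A))"
      using cut_remove[OF finE e0(1), of a b A] ends by auto
    have i: "inside (E - {e0}) a b A = inside E a b A - of_bool (x \<in> A \<and> y \<in> A)"
      using inside_remove[OF finE e0(1), of a b A] ends by auto
    have qq: "sum (q(x := q x - 1)) A = sum q A - of_bool (x \<in> A)"
      using sum_fun_upd_int[OF fA, of q x "q x - 1"] by simp
    show "admissible k (E - {e0}) a b (q(x := q x - 1)) up dn' 0 0 A"
      unfolding admissible_def
    proof (intro exI[of _ "r - of_bool (x \<in> A \<and> y \<notin> A)"] conjI)
      show "k dvd r - of_bool (x \<in> A \<and> y \<notin> A) -
        (sum (q(x := q x - 1)) A - inside (E - {e0}) a b A)"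
        unfolding i qq by (rule dvd_subst[OF r(1)]) (cases "x \<in> A"; cases "y \<in> A"; simp)
      show "k - 1 - sum dn' A + 0 \<le> r - of_bool (x \<in> A \<and> y \<notin> A)" using r(2) by simp
      show "r - of_bool (x \<in> A \<and> y \<notin> A) \<le> cut (E - {e0}) a b A - (k - 1) + sum up A - 0"
        unfolding c using r(3) by (cases "x \<in> A"; cases "y \<in> A") auto
    qed
  next
    fix v assume "v \<in> V" then show "0 \<le> dn' v" using more nonneg by force
  qed (use k2 finV neV finE endsV nonneg bud in auto)
  moreover have "x = a e0 \<or> x = b e0" using e0 by (auto simp: doubleton_eq_iff)
  ultimately show False using extend_by_edge e0 by blast
qed

text \<open>At a balanced vertex, at least half of the edges are not phantoms: for otherwise the phantom edges at the other vertices are too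
few for the complement of \<open>v\<close> to be admissible.\<close>

lemma balanced_degree:
  assumes v: "v \<in> V" and bal: "balanced_at k E a b q up dn v"
    and admissibles: "\<And>A. A \<noteq> {} \<Longrightarrow> A \<subset> V \<Longrightarrow> A \<noteq> {v} \<Longrightarrow> admissible k E a b q up dn 0 0 A"
  shows "up v + dn v \<le> cut E a b {v}"
proof -
  obtain c where c: "cut E a b {v} + up v - dn v = 2 * c" "k dvd q v - inside E a b {v} - c"
    using bal unfolding balanced_at_def by blast
  define B where "B = V - {v}"
  define d where "d = cut E a b {v}"
  have "B \<noteq> {}" "B \<subset> V" "B \<noteq> {v}" using singleton_proper[OF v] v unfolding B_def by auto
  then have "admissible k E a b q up dn 0 0 B" by (rule admissibles)
  then obtain r where r: "k dvd r - (sum q B - inside E a b B)" "k - 1 - sum dn B + 0 \<le> r"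
     "r \<le> cut E a b B - (k - 1) + sum up B - 0"
    unfolding admissible_def by blast
  have sums: "sum f B = sum f V - f v" for f :: "'v \<Rightarrow> int"
    unfolding B_def using v finV by (simp add: sum_diff1)
  have cutB: "cut E a b B = d" unfolding d_def
    by (rule cut_compl) (use endsV in \<open>auto simp: B_def\<close>)
  have "inside E a b B + inside E a b {v} + d = 
     (\<Sum>e\<in>E. of_bool (a e \<in> B \<and> b e \<in> B) + of_bool (a e \<in> {v} \<and> b e \<in> {v}) + 
        of_bool ((a e \<in> {v}) \<noteq> (b e \<in> {v})))"
    unfolding inside_def d_def cut_def by (simp only: sum.distrib)
  also have "\<dots> = (\<Sum>e\<in>E. 1)"
  proof (intro sum.cong refl)
    fix e assume "e \<in> E"
    then show "of_bool (a e \<in> B \<and> b e \<in> B) + of_bool (a e \<in> {v} \<and> b e \<in> {v}) + 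
        of_bool ((a e \<in> {v}) \<noteq> (b e \<in> {v})) = (1::int)"
      using endsV[of e] unfolding B_def by auto
  qed
  finally have ins: "inside E a b B = int (card E) - inside E a b {v} - d" by simp
  have "k dvd r - (sum q B - inside E a b B) + (sum q V - int (card E)) - (q v - inside E a b {v} - c)"
    by (rule dvd_diff[OF dvd_add[OF r(1) total] c(2)])
  then have "k dvd r - (d - c)" by (rule dvd_subst) (use ins sums[of q] in simp)
  \<comment> \<open>Admissibility of the complement \<open>B\<close> of \<open>v\<close>; for either alternative of the budget, one of the two bounds on
    \<open>r\<close> gives the claim, depending on the sign of \<open>j\<close>.\<close>
  then obtain j where j: "r = d - c + k * j" by (metis add.commute diff_add_cancel dvdE)
  have jle: "k * j \<le> k * x" if "j \<le> x" for x using k2 that by (intro mult_left_mono) auto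
  have jge: "k * x \<le> k * j" if "x \<le> j" for x using k2 that by (intro mult_left_mono) auto
  have j0: "k * j \<le> 0 \<or> k \<le> k * j" using jle[of 0] jge[of 1] by linarith
  have j1: "0 \<le> k * j \<or> k * j \<le> - k" using jge[of 0] jle[of "-1"] by linarith
  from budg show ?thesis unfolding budget_def
  proof
    assume "sum up V \<le> 2 * k - 1 \<and> sum dn V \<le> k - 1"
    then show ?thesis using j0 j r(2,3) c(1) sums[of up] sums[of dn] cutB unfolding d_def by linarith
  next
    assume "sum up V \<le> k - 1 \<and> sum dn V \<le> 2 * k - 1"
    then show ?thesis using j1 j r(2,3) c(1) sums[of up] sums[of dn] cutB unfolding d_def by linarith
  qed
qed

text \<open>A phantom edge into \<open>v\<close> and an edge from \<open>v\<close> to \<open>w\<close> are lifted to a phantom edge into \<open>w\<close>.\<close>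

lemma no_up_at_balanced:
  assumes v: "v \<in> V" and bal: "balanced_at k E a b q up dn v"
    and admissibles: "\<And>A. A \<noteq> {} \<Longrightarrow> A \<subset> V \<Longrightarrow> A \<noteq> {v} \<Longrightarrow> admissible k E a b q up dn 0 0 A"
  shows "up v = 0"
proof (rule ccontr)
  assume "up v \<noteq> 0"
  then have up1: "1 \<le> up v" using nonneg(1)[OF v] by linarith
  then have "1 \<le> cut E a b {v}" using balanced_degree[OF assms] nonneg(2)[OF v] by linarith
  then obtain e0 x w where e0: "e0 \<in> E" "{a e0, b e0} = {x, w}" "x \<in> {v}" "w \<notin> {v}"
    by (rule crossing_edge)
  then have xw: "x = v" "w \<noteq> v" by auto
  have ends: "a e0 = v \<and> b e0 = w \<or> a e0 = w \<and> b e0 = v" 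
    using e0(2) xw by (auto simp: doubleton_eq_iff)
  have wV: "w \<in> V" using ends endsV[OF e0(1)] by auto
  define q' where "q' = q(v := q v - 1)"
  define up' where "up' = up(v := up v - 1, w := up w + 1)"
  have c: "cut (E - {e0}) a b A = cut E a b A - of_bool ((v \<in> A) \<noteq> (w \<in> A))" for A
    using cut_remove[OF finE e0(1), of a b A] ends by auto
  have i: "inside (E - {e0}) a b A = inside E a b A - of_bool (v \<in> A \<and> w \<in> A)" for A
    using inside_remove[OF finE e0(1), of a b A] ends by auto
  have qq: "sum q' A = sum q A - of_bool (v \<in> A)" if "finite A" for A
    unfolding q'_def using sum_fun_upd_int[OF that, of q v "q v - 1"] by simp
  have uu: "sum up' A = sum up A - of_bool (v \<in> A) + of_bool (w \<in> A)" if "finite A" for A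
    unfolding up'_def using sum_fun_upd_int[OF that, of up v "up v - 1"] 
      sum_fun_upd_int[OF that, of "up(v := up v - 1)" w "up w + 1"] xw by simp
  have "feasible k V (E - {e0}) a b q' up' dn {v}"
    unfolding feasible_def
  proof (intro conjI ballI allI impI)
    show "k dvd sum q' V - int (card (E - {e0}))"
      using total cardE_remove[OF e0(1)] qq[OF finV] v by simp
    show "budget k (sum up' V) (sum dn V)" using budg uu[OF finV] v wV by simp
    show "{v} = {} \<or> (\<exists>va\<in>V. {v} = {va} \<and> balanced_at k (E - {e0}) a b q' up' dn va)"
    proof -
      obtain c0 where c0: "cut E a b {v} + up v - dn v = 2 * c0" "k dvd q v - inside E a b {v} - c0"
        using bal unfolding balanced_at_def by blast
      have "balanced_at k (E - {e0}) a b q' up' dn v"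
        unfolding balanced_at_def
      proof (intro exI[of _ "c0 - 1"] conjI)
        show "cut (E - {e0}) a b {v} + up' v - dn v = 2 * (c0 - 1)"
          using c[of "{v}"] c0(1) xw unfolding up'_def by simp
        show "k dvd q' v - inside (E - {e0}) a b {v} - (c0 - 1)"
          by (rule dvd_subst[OF c0(2)]) (use i[of "{v}"] xw in \<open>simp add: q'_def\<close>)
      qed
      then show ?thesis using v by blast
    qed
  next
    fix A assume A: "A \<noteq> {} \<and> A \<subset> V \<and> A \<noteq> {v}"
    then have fA: "finite A" using finV finite_subset by blast
    define \<delta> :: int where "\<delta> = of_bool (v \<in> A \<and> w \<notin> A)"
    have "admissible k E a b q up dn \<delta> \<delta> A"
    proof (rule single_or_big[of A])
      fix z assume z: "A = {z}"
      then have "\<delta> = 0" using A unfolding \<delta>_def by auto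
      then show ?thesis using admissibles A by simp
    next
      assume "2 \<le> card A"
      then have "admissible k E a b q up dn 1 1 A" using strictly_admissible A by blast
      then show ?thesis by (rule admissible_mono) (auto simp: \<delta>_def)
    qed (use A in auto)
    then obtain r where r: "k dvd r - (sum q A - inside E a b A)"
       "k - 1 - sum dn A + \<delta> \<le> r" "r \<le> cut E a b A - (k - 1) + sum up A - \<delta>"
      unfolding admissible_def by blast
    show "admissible k (E - {e0}) a b q' up' dn 0 0 A"
      unfolding admissible_def i c qq[OF fA] uu[OF fA]
    proof (intro exI[of _ "r - \<delta>"] conjI)
      show "k dvd r - \<delta> - (sum q A - of_bool (v \<in> A) - (inside E a b A - of_bool (v \<in> A \<and> w \<in> A)))"
        by (rule dvd_subst[OF r(1)]) (cases "v \<in> A"; cases "w \<in> A"; simp add: \<delta>_def)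
      show "k - 1 - sum dn A + 0 \<le> r - \<delta>" using r(2) by linarith
      show "r - \<delta> \<le> cut E a b A - of_bool ((v \<in> A) \<noteq> (w \<in> A)) - (k - 1) +
        (sum up A - of_bool (v \<in> A) + of_bool (w \<in> A)) - 0"
        using r(3) by (cases "v \<in> A"; cases "w \<in> A"; simp add: \<delta>_def)
    qed
  next
    fix u assume "u \<in> V" then show "0 \<le> up' u" "0 \<le> dn u" 
      using nonneg up1 unfolding up'_def by (auto simp: add_nonneg_nonneg)
  qed (use k2 finV neV finE endsV in auto)
  then show False using extend_by_edge[OF e0(1), of v] ends unfolding q'_def by blast
qed

text \<open>After the phantom edges at \<open>v\<close>, pairs of other edges are lifted. A pair of parallel edges cannot be lifted, since this
would decrease the degree of the only neighbour \<open>w\<close>; but then the edges between \<open>v\<close> and \<open>w\<close> are contracted, which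
is harmless as sets that contain both \<open>v\<close> and \<open>w\<close> are admissible.\<close>

lemma no_balanced_vertex:
  assumes v: "v \<in> V" and bal: "balanced_at k E a b q up dn v"
    and admissibles: "\<And>A. A \<noteq> {} \<Longrightarrow> A \<subset> V \<Longrightarrow> A \<noteq> {v} \<Longrightarrow> admissible k E a b q up dn 0 0 A"
  shows False
proof -
  interpret M: least_counterexample k V E a b "mirror E a b q" dn up X by (rule mirrored)
  have up0: "up v = 0" by (rule no_up_at_balanced[OF assms])
  have dn0: "dn v = 0"
  proof (rule M.no_up_at_balanced[OF v])
    show "balanced_at k E a b (mirror E a b q) dn up v" using bal by (rule mirror_balanced)
    show "admissible k E a b (mirror E a b q) dn up 0 0 A" if "A \<noteq> {}" "A \<subset> V" "A \<noteq> {v}" for A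
    proof -
      have "finite A" using that(2) finV finite_subset by blast
      then show ?thesis using admissibles[OF that] mirror_admissible by blast
    qed
  qed
  obtain c where c: "cut E a b {v} = 2 * c" "k dvd q v - inside E a b {v} - c"
    using bal up0 dn0 unfolding balanced_at_def by auto
  define D where "D = {e \<in> E. (a e = v) \<noteq> (b e = v)}"
  define other where "other e = (if a e = v then b e else a e)" for e
  have otherV: "other e \<in> V" "other e \<noteq> v" if "e \<in> D" for e
    using that endsV unfolding D_def other_def by auto
  have finD: "finite D" using finE unfolding D_def by simp
  have cardD: "int (card D) = 2 * c"
  proof -
    have "cut E a b {v} = int (card D)" unfolding cut_def D_def using finE by (simp add: Int_def)
    then show ?thesis using c(1) by simp
  qed
  show False
  proof (cases "\<exists>e1\<in>D. \<exists>e2\<in>D. other e1 \<noteq> other e2")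
    case False
    \<comment> \<open>All edges at \<open>v\<close> lead to one vertex \<open>w\<close>: contract \<open>{v, w}\<close> and give \<open>v\<close> equally many edges in and out.\<close>
    obtain w where w: "w \<in> V" "w \<noteq> v" "\<And>e. e \<in> D \<Longrightarrow> other e = w"
    proof (cases "D = {}")
      case True
      obtain w where "w \<in> V" "w \<noteq> v" using singleton_proper[OF v] by auto
      then show ?thesis using True that by blast
    next
      case nonempty: False
      then obtain e where "e \<in> D" by blast
      then show ?thesis using that[of "other e"] otherV[of e] False by blast
    qed
    have A: "{v, w} \<subseteq> V" "2 \<le> card {v, w}" using v w by auto
    obtain t where t: "\<And>e. e \<in> E \<Longrightarrow> t e = a e \<or> t e = b e"
      "\<And>u. u \<in> V - {v, w} \<Longrightarrow> k dvd outs E t u - q u"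
      "k dvd sum (outs E t) {v, w} - sum q {v, w}"
      using contraction[OF A] by blast
    define EA where "EA = {e \<in> E. a e \<in> {v, w} \<and> b e \<in> {v, w}}"
    have EAE: "EA \<subseteq> E" unfolding EA_def by auto
    have finEA: "finite EA" using finE EAE finite_subset by blast
    have DEA: "D \<subseteq> EA"
    proof
      fix e assume e: "e \<in> D"
      from w(3)[OF e] e show "e \<in> EA" unfolding D_def EA_def other_def by (auto split: if_splits)
    qed
    have c0: "0 \<le> c" using cardD by linarith
    obtain D1 where D1: "D1 \<subseteq> D" "card D1 = nat c"
      using obtain_subset_with_card_n[of "nat c" D] cardD by (metis c0 int_nat_eq mult_2 of_nat_0_le_iff of_nat_le_iff le_add_same_cancel1)
    define s where "s e = (if e \<in> D1 then v else if e \<in> D then w else a e)" for e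
    have s_in: "s e = a e \<or> s e = b e" if "e \<in> EA" for e
    proof (cases "e \<in> D")
      case True
      then have "{a e, b e} = {v, w}" using w(3)[OF True] unfolding D_def other_def by (auto split: if_splits)
      then show ?thesis unfolding s_def by (auto simp: doubleton_eq_iff)
    next
      case False
      then show ?thesis using D1(1) unfolding s_def by auto
    qed
    have outv: "outs EA s v = c + inside E a b {v}"
    proof -
      have "outs EA s v = (\<Sum>e\<in>EA. of_bool (e \<in> D1) + of_bool (a e \<in> {v} \<and> b e \<in> {v}))"
        unfolding outs_def
      proof (intro sum.cong refl)
        fix e assume "e \<in> EA"
        then show "of_bool (s e = v) = (of_bool (e \<in> D1) + of_bool (a e \<in> {v} \<and> b e \<in> {v}) :: int)"
          using D1(1) w(2) EAE unfolding s_def D_def by auto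
      qed
      also have "\<dots> = (\<Sum>e\<in>EA. of_bool (e \<in> D1)) + inside EA a b {v}"
        unfolding inside_def by (rule sum.distrib)
      also have "(\<Sum>e\<in>EA. of_bool (e \<in> D1)) = int (card (EA \<inter> D1))"
        using finEA by (simp add: Int_def)
      also have "EA \<inter> D1 = D1" using D1(1) DEA by auto
      also have "int (card D1) = c" using D1(2) c0 by simp
      also have "inside EA a b {v} = inside E a b {v}"
        unfolding inside_def using finE EAE
        by (intro sum.mono_neutral_left) (auto simp: EA_def)
      finally show ?thesis .
    qed
    have outer: "outs (E - EA) t v = 0"
    proof -
      have "t e \<noteq> v" if "e \<in> E - EA" for e
      proof
        assume tv: "t e = v"
        have eE: "e \<in> E" using that by simp
        have "e \<notin> D" using that DEA by auto
        then have "a e = v \<and> b e = v" using t(1)[OF eE] tv eE unfolding D_def by auto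
        then show False using that unfolding EA_def by auto
      qed
      then show ?thesis unfolding outs_def by (intro sum.neutral) auto
    qed
    have "s e \<in> {v, w}" if "e \<in> EA" for e using s_in[OF that] that unfolding EA_def by auto
    then have s_all: "sum (outs EA s) {v, w} = int (card EA)"
      using sum_outs[of "{v, w}" EA s] sum.cong[of EA EA "\<lambda>e. of_bool (s e \<in> {v, w})" "\<lambda>e. 1 :: int"] by auto
    have "t e \<in> {v, w}" if "e \<in> EA" for e using t(1)[of e] that unfolding EA_def by auto
    then have t_all: "sum (outs EA t) {v, w} = int (card EA)"
      using sum_outs[of "{v, w}" EA t] sum.cong[of EA EA "\<lambda>e. of_bool (t e \<in> {v, w})" "\<lambda>e. 1 :: int"] by auto
    have vdvd: "k dvd q v - outs EA s v" by (rule dvd_subst[OF c(2)]) (simp add: outv)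
    show False
    proof (rule glue[OF t(1,2) EA_def])
      fix u assume "u \<in> {v, w}"
      then consider "u = v" | "u = w" by auto
      then show "k dvd outs EA s u + outs (E - EA) t u - q u"
      proof cases
        case 1
        have "k dvd - (q v - outs EA s v)" using vdvd by (simp only: dvd_minus_iff)
        then show ?thesis by (rule dvd_subst) (simp add: 1 outer)
      next
        case 2
        have "k dvd sum (outs E t) {v, w} - sum q {v, w} + (q v - outs EA s v)"
          by (rule dvd_add[OF t(3) vdvd])
        then show ?thesis
          by (rule dvd_subst) (use w(2) s_all t_all outer outs_split[OF finE EAE, of t] 2 in simp)
      qed
    qed (use s_in in auto)
  next
    case True
    \<comment> \<open>Two edges lead to distinct vertices \<open>y\<close> and \<open>w\<close>: they are lifted to a single edge between \<open>y\<close> and \<open>w\<close>, namely \<open>e1\<close>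
      with new ends.\<close>
    then obtain e1 e2 where e12: "e1 \<in> D" "e2 \<in> D" "other e1 \<noteq> other e2" by blast
    define y where "y = other e1"
    define w where "w = other e2"
    have yw: "y \<noteq> w" "y \<noteq> v" "w \<noteq> v" "y \<in> V" "w \<in> V"
      using e12 otherV unfolding y_def w_def by auto
    have eE: "e1 \<in> E" "e2 \<in> E" "e1 \<noteq> e2" using e12 unfolding D_def by auto
    have ends1: "a e1 = v \<and> b e1 = y \<or> a e1 = y \<and> b e1 = v"
      using e12(1) unfolding D_def y_def other_def by auto
    have ends2: "a e2 = v \<and> b e2 = w \<or> a e2 = w \<and> b e2 = v"
      using e12(2) unfolding D_def w_def other_def by auto
    define E' where "E' = E - {e2}"
    define a' where "a' = a(e1 := y)"
    define b' where "b' = b(e1 := w)"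
    define q' where "q' = q(v := q v - 1)"
    have fE': "finite E'" "e1 \<in> E'" using finE eE unfolding E'_def by auto
    have rest: "E' - {e1} = E - {e2} - {e1}" unfolding E'_def by simp
    have cut': "cut E' a' b' A = cut E a b A - of_bool ((v \<in> A) \<noteq> (w \<in> A)) - of_bool ((v \<in> A) \<noteq> (y \<in> A))
        + of_bool ((y \<in> A) \<noteq> (w \<in> A))" for A
    proof -
      have "cut E' a' b' A = cut (E' - {e1}) a' b' A + of_bool ((y \<in> A) \<noteq> (w \<in> A))"
        using cut_remove[OF fE', of a' b' A] unfolding a'_def b'_def by simp
      also have "cut (E' - {e1}) a' b' A = cut (E' - {e1}) a b A"
        unfolding cut_def by (intro sum.cong) (auto simp: a'_def b'_def)
      also have "\<dots> = cut E' a b A - of_bool ((v \<in> A) \<noteq> (y \<in> A))"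
        using cut_remove[OF fE', of a b A] ends1 by auto
      also have "cut E' a b A = cut E a b A - of_bool ((v \<in> A) \<noteq> (w \<in> A))"
        using cut_remove[OF finE eE(2), of a b A] ends2 unfolding E'_def by auto
      finally show ?thesis .
    qed
    have ins': "inside E' a' b' A = inside E a b A - of_bool (v \<in> A \<and> w \<in> A) - of_bool (v \<in> A \<and> y \<in> A)
        + of_bool (y \<in> A \<and> w \<in> A)" for A
    proof -
      have "inside E' a' b' A = inside (E' - {e1}) a' b' A + of_bool (y \<in> A \<and> w \<in> A)"
        using inside_remove[OF fE', of a' b' A] unfolding a'_def b'_def by simp
      also have "inside (E' - {e1}) a' b' A = inside (E' - {e1}) a b A"
        unfolding inside_def by (intro sum.cong) (auto simp: a'_def b'_def)
      also have "\<dots> = inside E' a b A - of_bool (v \<in> A \<and> y \<in> A)"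
        using inside_remove[OF fE', of a b A] ends1 by auto
      also have "inside E' a b A = inside E a b A - of_bool (v \<in> A \<and> w \<in> A)"
        using inside_remove[OF finE eE(2), of a b A] ends2 unfolding E'_def by auto
      finally show ?thesis .
    qed
    have qq: "sum q' A = sum q A - of_bool (v \<in> A)" if "finite A" for A
      unfolding q'_def using sum_fun_upd_int[OF that, of q v "q v - 1"] by simp
    have "feasible k V E' a' b' q' up dn {v}"
      unfolding feasible_def
    proof (intro conjI ballI allI impI)
      show "k dvd sum q' V - int (card E')"
        using total cardE_remove[OF eE(2)] qq[OF finV] v unfolding E'_def by simp
      have "balanced_at k E' a' b' q' up dn v"
        unfolding balanced_at_def
      proof (intro exI[of _ "c - 1"] conjI)
        show "cut E' a' b' {v} + up v - dn v = 2 * (c - 1)"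
          using cut'[of "{v}"] c(1) yw up0 dn0 by simp
        show "k dvd q' v - inside E' a' b' {v} - (c - 1)"
          by (rule dvd_subst[OF c(2)]) (use ins'[of "{v}"] yw in \<open>simp add: q'_def\<close>)
      qed
      then show "{v} = {} \<or> (\<exists>va\<in>V. {v} = {va} \<and> balanced_at k E' a' b' q' up dn va)"
        using v by blast
    next
      fix A assume A: "A \<noteq> {} \<and> A \<subset> V \<and> A \<noteq> {v}"
      then have fA: "finite A" using finV finite_subset by blast
      define \<delta> :: int where "\<delta> = of_bool ((v \<in> A) \<noteq> (y \<in> A) \<and> (v \<in> A) \<noteq> (w \<in> A))"
      have "admissible k E a b q up dn \<delta> \<delta> A"
      proof (rule single_or_big[of A])
        fix z assume z: "A = {z}"
        then have "\<delta> = 0" using A yw unfolding \<delta>_def by auto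
        then show ?thesis using admissibles A by simp
      next
        assume "2 \<le> card A"
        then have "admissible k E a b q up dn 1 1 A" using strictly_admissible A by blast
        then show ?thesis by (rule admissible_mono) (auto simp: \<delta>_def)
      qed (use A in auto)
      then obtain r where r: "k dvd r - (sum q A - inside E a b A)"
         "k - 1 - sum dn A + \<delta> \<le> r" "r \<le> cut E a b A - (k - 1) + sum up A - \<delta>"
        unfolding admissible_def by blast
      show "admissible k E' a' b' q' up dn 0 0 A"
        unfolding admissible_def ins' cut' qq[OF fA]
      proof (intro exI[of _ "r - \<delta>"] conjI)
        show "k dvd r - \<delta> - (sum q A - of_bool (v \<in> A) - (inside E a b A - of_bool (v \<in> A \<and> w \<in> A)
           - of_bool (v \<in> A \<and> y \<in> A) + of_bool (y \<in> A \<and> w \<in> A)))"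
          by (rule dvd_subst[OF r(1)]) (cases "v \<in> A"; cases "w \<in> A"; cases "y \<in> A"; simp add: \<delta>_def)
        show "k - 1 - sum dn A + 0 \<le> r - \<delta>" using r(2) by linarith
        show "r - \<delta> \<le> cut E a b A - of_bool ((v \<in> A) \<noteq> (w \<in> A)) - of_bool ((v \<in> A) \<noteq> (y \<in> A))
          + of_bool ((y \<in> A) \<noteq> (w \<in> A)) - (k - 1) + sum up A - 0"
          using r(3) by (cases "v \<in> A"; cases "w \<in> A"; cases "y \<in> A"; simp add: \<delta>_def)
      qed
    next
      fix e assume "e \<in> E'"
      then show "a' e \<in> V" "b' e \<in> V" using endsV yw unfolding a'_def b'_def E'_def by auto
    qed (use k2 finV neV fE' nonneg budg in auto)
    moreover have "card E' < card E" using eE(2) finE unfolding E'_def by (meson card_Diff1_less)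
    ultimately obtain t where t: "mod_orientation k V E' a' b' q' t" using least by force
    have te: "t e = (a(e1 := y)) e \<or> t e = (b(e1 := w)) e" if "e \<in> E - {e2}" for e
      using t that unfolding mod_orientation_def a'_def b'_def E'_def by blast
    have sets: "{a e1, b e1} = {v, y}" "{a e2, b e2} = {v, w}" using ends1 ends2 by auto
    obtain s where s: "\<And>e. e \<in> E \<Longrightarrow> s e = a e \<or> s e = b e"
      "\<And>u. outs E s u = outs (E - {e2}) t u + of_bool (u = v)"
      using unlift[OF finE eE sets te] by blast
    have "mod_orientation k V E a b q s"
      unfolding mod_orientation_def
    proof (intro conjI ballI)
      fix u assume "u \<in> V"
      then have "k dvd outs E' t u - q' u" using t unfolding mod_orientation_def by blast
      then show "k dvd outs E s u - q u"
        by (rule dvd_subst) (simp add: s(2) q'_def E'_def)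
    qed (use s(1) in blast)
    then show False using none by blast
  qed
qed

lemma X_empty: "X = {}"
proof (rule ccontr)
  assume "X \<noteq> {}"
  then obtain v where v: "v \<in> V" "X = {v}" "balanced_at k E a b q up dn v" using Xcase by auto
  show False by (rule no_balanced_vertex[OF v(1,3)]) (use admissibleA v(2) in blast)
qed

lemma admissible_proper: "A \<noteq> {} \<Longrightarrow> A \<subset> V \<Longrightarrow> admissible k E a b q up dn 0 0 A"
  using admissibleA X_empty by blast

text \<open>A vertex without any slack has \<open>2 * k - 2\<close> edges, phantoms included, and is balanced.\<close>

lemma out_or_in:
  assumes v: "v \<in> V"
  shows "admissible k E a b q up dn 1 0 {v} \<or> admissible k E a b q up dn 0 1 {v}"
proof (rule ccontr)
  assume no: "\<not> ?thesis"
  have "admissible k E a b q up dn 0 0 {v}" using admissible_proper[of "{v}"] singleton_proper[OF v] by simp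
  then obtain r where r: "k dvd r - (q v - inside E a b {v})"
     "k - 1 - dn v \<le> r" "r \<le> cut E a b {v} - (k - 1) + up v"
    unfolding admissible_def by auto
  have "\<not> k - 1 - dn v + 1 \<le> r" "\<not> r \<le> cut E a b {v} - (k - 1) + up v - 1"
    using no r unfolding admissible_def by auto
  then have eq: "r = k - 1 - dn v" "r = cut E a b {v} - (k - 1) + up v" using r by linarith+
  have "k dvd - (r - (q v - inside E a b {v}))" using r(1) by (simp only: dvd_minus_iff)
  then have "k dvd q v - inside E a b {v} - r" by (rule dvd_subst) simp
  moreover have "cut E a b {v} + up v - dn v = 2 * r" using eq by linarith
  ultimately have "balanced_at k E a b q up dn v" unfolding balanced_at_def by blast
  then show False using no_balanced_vertex[OF v] admissible_proper by blast
qed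

text \<open>Dropping a phantom edge out of \<open>v\<close> raises the lower bound by one for each set that contains \<open>v\<close>, which the slack permits.\<close>

lemma no_dn_at_out:
  assumes v: "v \<in> V" and s: "admissible k E a b q up dn 1 0 {v}"
  shows "dn v = 0"
proof (rule ccontr)
  assume "dn v \<noteq> 0"
  then have dn1: "1 \<le> dn v" using nonneg(2)[OF v] by linarith
  define dn' where "dn' = dn(v := dn v - 1)"
  have dd: "sum dn' A = sum dn A - of_bool (v \<in> A)" if "finite A" for A
    unfolding dn'_def using sum_fun_upd_int[OF that, of dn v "dn v - 1"] by simp
  have "feasible k V E a b q up dn' {}"
    unfolding feasible_def
  proof (intro conjI ballI allI impI)
    show "budget k (sum up V) (sum dn' V)" using budg dd[OF finV] v unfolding budget_def by auto
  next
    fix A assume A: "A \<noteq> {} \<and> A \<subset> V \<and> A \<noteq> {}"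
    then have fA: "finite A" using finV finite_subset by blast
    define \<delta> :: int where "\<delta> = of_bool (v \<in> A)"
    have "admissible k E a b q up dn \<delta> 0 A"
    proof (rule single_or_big[of A])
      fix z assume z: "A = {z}"
      show ?thesis
      proof (cases "z = v")
        case True then show ?thesis using s z unfolding \<delta>_def by simp
      next
        case False then show ?thesis using admissible_proper[of A] A z unfolding \<delta>_def by simp
      qed
    next
      assume "2 \<le> card A"
      then have "admissible k E a b q up dn 1 1 A" using strictly_admissible A by blast
      then show ?thesis by (rule admissible_mono) (auto simp: \<delta>_def)
    qed (use A in auto)
    then show "admissible k E a b q up dn' 0 0 A"
      unfolding admissible_def dd[OF fA] \<delta>_def by (auto simp: algebra_simps)
  next
    fix u assume "u \<in> V" then show "0 \<le> dn' u" using nonneg dn1 unfolding dn'_def by auto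
  qed (use k2 finV neV finE endsV nonneg total in auto)
  moreover have "nat (sum up V + sum dn' V) < nat (sum up V + sum dn V)"
  proof -
    have "dn v \<le> sum dn V" using finV v nonneg(2) by (intro member_le_sum) auto
    moreover have "0 \<le> sum up V" using nonneg(1) by (intro sum_nonneg)
    ultimately show ?thesis using dd[OF finV] v dn1 by auto
  qed
  ultimately show False using least none by force
qed

text \<open>If no edge leaves \<open>A\<close>, the intervals for \<open>A\<close> and for its complement can be nonempty only by means of phantom edges, and the budget
is too small for both; in the borderline case \<open>k = 2\<close> a residue is wrong.\<close>

lemma cut_pos:
  assumes A: "A \<noteq> {}" "A \<subset> V"
  shows "1 \<le> cut E a b A"
proof (rule ccontr)
  assume "\<not> ?thesis"
  then have cA: "cut E a b A = 0" using cut_nonneg[of E a b A] by linarith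
  define B where "B = V - A"
  have B: "B \<noteq> {}" "B \<subset> V" using A unfolding B_def by auto
  have cB: "cut E a b B = 0"
    using cA cut_compl[of E a B A b] endsV unfolding B_def by simp
  obtain r where r: "k dvd r - (sum q A - inside E a b A)"
     "k - 1 - sum dn A \<le> r" "r \<le> - (k - 1) + sum up A"
    using admissible_proper[OF A] cA unfolding admissible_def by auto
  obtain r' where r': "k dvd r' - (sum q B - inside E a b B)"
     "k - 1 - sum dn B \<le> r'" "r' \<le> - (k - 1) + sum up B"
    using admissible_proper[OF B] cB unfolding admissible_def by auto
  have sums: "sum f A + sum f B = sum f V" for f :: "'v \<Rightarrow> int"
    unfolding B_def using A finV by (simp add: sum.subset_diff[of A V])
  have "inside E a b A + inside E a b B + cut E a b A = (\<Sum>e\<in>E. of_bool (a e \<in> A \<and> b e \<in> A) +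
     of_bool (a e \<in> B \<and> b e \<in> B) + of_bool ((a e \<in> A) \<noteq> (b e \<in> A)))"
    unfolding inside_def cut_def by (simp only: sum.distrib)
  also have "\<dots> = (\<Sum>e\<in>E. 1)"
  proof (intro sum.cong refl)
    fix e assume "e \<in> E"
    then show "of_bool (a e \<in> A \<and> b e \<in> A) + of_bool (a e \<in> B \<and> b e \<in> B) +
        of_bool ((a e \<in> A) \<noteq> (b e \<in> A)) = (1::int)"
      using endsV[of e] unfolding B_def by auto
  qed
  finally have ins: "inside E a b A + inside E a b B = int (card E)" using cA by simp
  have "k dvd (r - (sum q A - inside E a b A)) + (r' - (sum q B - inside E a b B)) + (sum q V - int (card E))"
    by (rule dvd_add[OF dvd_add[OF r(1) r'(1)] total])
  then have "k dvd r + r'" by (rule dvd_subst) (use ins sums[of q] in simp)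
  then obtain j where j: "r + r' = k * j" by blast
  have b1: "2 * k - 2 - sum dn V \<le> k * j" using r(2) r'(2) j sums[of dn] by linarith
  have b2: "k * j \<le> sum up V - 2 * k + 2" using r(3) r'(3) j sums[of up] by linarith
  have jle: "k * j \<le> k * x" if "j \<le> x" for x using k2 that by (intro mult_left_mono) auto
  have jge: "k * x \<le> k * j" if "x \<le> j" for x using k2 that by (intro mult_left_mono) auto
  show False
    using budg jle[of 0] jge[of 1] jge[of 0] jle[of "-1"] b1 b2 k2 unfolding budget_def by linarith
qed

text \<open>No vertex has slack at the upper bound, so each has slack at the lower bound and there are no phantom edges out of vertices. For an edge
\<open>x w\<close>, as many such phantom edges are added at \<open>w\<close> as are needed to orient \<open>x w\<close> towards \<open>w\<close>.\<close>

lemma not_all_out: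
  assumes "\<And>v. v \<in> V \<Longrightarrow> admissible k E a b q up dn 1 0 {v} \<and> \<not> admissible k E a b q up dn 0 1 {v}"
  shows False
proof -
  have dn0: "dn v = 0" if "v \<in> V" for v using no_dn_at_out that assms by blast
  obtain v where v: "v \<in> V" using neV by blast
  obtain e x w where e: "e \<in> E" "{a e, b e} = {x, w}" "x \<in> {v}" "w \<notin> {v}"
    using crossing_edge[OF cut_pos[of "{v}"]] singleton_proper[OF v] by blast
  have xw: "x \<in> V" "w \<in> V" "x \<noteq> w" using e endsV[OF e(1)] by (auto simp: doubleton_eq_iff)
  obtain r where r: "k dvd r - (q w - inside E a b {w})"
     "k - 1 + 1 \<le> r" "r \<le> cut E a b {w} - (k - 1) + up w"
    using assms[OF xw(2)] dn0[OF xw(2)] unfolding admissible_def by auto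
  have no: "\<not> (k - 1 \<le> x \<and> x \<le> cut E a b {w} - (k - 1) + up w - 1)" 
    if "k dvd x - (q w - inside E a b {w})" for x
    using assms[OF xw(2)] dn0[OF xw(2)] that unfolding admissible_def by auto
  have rk: "k dvd (r - k) - (q w - inside E a b {w})"
    by (rule dvd_subst[OF dvd_diff[OF r(1) dvd_refl[of k]]]) simp
  have hi: "r = cut E a b {w} - (k - 1) + up w" using no[OF r(1)] r by linarith
  have lo: "r - k < k - 1" using no[OF rk] hi k2 by linarith
  \<comment> \<open>Just enough phantom edges out of \<open>w\<close> to make the next smaller number \<open>r - k\<close> admissible at \<open>w\<close>.\<close>
  define dn' where "dn' = dn(w := 2 * k - 1 - r)"
  show False
  proof (rule orient_edge[OF e(1,2) xw(3)])
    show "admissible k E a b q up dn 1 1 A" if "A \<subset> V" "2 \<le> card A" for A using strictly_admissible that by blast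
    show "X = {}" by (rule X_empty)
    show "dn u \<le> dn' u" if "u \<in> V" for u using dn0[OF that] lo unfolding dn'_def by auto
    have "sum dn' V = 2 * k - 1 - r"
      unfolding dn'_def using sum_fun_upd_int[OF finV, of dn w "2 * k - 1 - r"] dn0 xw(2) by simp
    then show "budget k (sum up V) (sum dn' V)" using budg r(2) k2 unfolding budget_def by auto
    show "admissible k E a b q up dn' 1 0 {x}"
      using assms[OF xw(1)] xw(3) unfolding admissible_def dn'_def by simp
    show "admissible k E a b q up dn' 0 1 {w}"
      unfolding admissible_def
      by (intro exI[of _ "r - k"]) (use rk hi k2 in \<open>simp add: dn'_def\<close>)
  qed
qed

lemma impossible: False
proof -
  interpret M: least_counterexample k V E a b "mirror E a b q" dn up X by (rule mirrored)
  define P where "P = {v \<in> V. admissible k E a b q up dn 1 0 {v}}"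
  define N where "N = {v \<in> V. admissible k E a b q up dn 0 1 {v}}"
  have PN: "P \<union> N = V" using out_or_in unfolding P_def N_def by auto
  have orient: False if "e \<in> E" "{a e, b e} = {x, y}" "x \<noteq> y" "x \<in> P" "y \<in> N" for e x y
  proof (rule orient_edge[OF that(1-3)])
    show "admissible k E a b q up dn 1 1 A" if "A \<subset> V" "2 \<le> card A" for A using strictly_admissible that by blast
    show "X = {}" by (rule X_empty)
    show "budget k (sum up V) (sum dn V)" by (rule budg)
  qed (use that in \<open>auto simp: P_def N_def\<close>)
  show False
  proof (cases "P = {}")
    case True
    then have N: "admissible k E a b q up dn 0 1 {v}" "\<not> admissible k E a b q up dn 1 0 {v}" if "v \<in> V" for v
      using that PN unfolding P_def N_def by auto
    show False
      by (rule M.not_all_out) (simp add: mirror_admissible N)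
  next
    case P0: False
    show False
    proof (cases "P = V")
      case False
      then have "P \<subset> V" unfolding P_def by auto
      then obtain e x y where e: "e \<in> E" "{a e, b e} = {x, y}" "x \<in> P" "y \<notin> P"
        using crossing_edge[OF cut_pos[OF P0]] by blast
      have "y \<in> V" using e endsV[OF e(1)] by (auto simp: doubleton_eq_iff)
      then show False using orient[OF e(1,2)] e(3,4) PN by blast
    next
      case True
      show False
      proof (cases "N = {}")
        case empty: True
        show False
          by (rule not_all_out) (use empty True in \<open>auto simp: P_def N_def\<close>)
      next
        case False
        then obtain y where y: "y \<in> N" by blast
        then have yV: "y \<in> V" unfolding N_def by simp
        obtain e y' x where e: "e \<in> E" "{a e, b e} = {y', x}" "y' \<in> {y}" "x \<notin> {y}"
          using crossing_edge[OF cut_pos[of "{y}"]] singleton_proper[OF yV] by blast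
        have "x \<in> V" using e endsV[OF e(1)] by (auto simp: doubleton_eq_iff)
        then show False using orient[of e x y] e True y by (auto simp: insert_commute)
      qed
    qed
  qed
qed

end

theorem mod_orientation_exists:
  assumes "feasible k V E a b q up dn X"
  shows "\<exists>t. mod_orientation k V E a b q t"
proof -
  have "wf (less_than <*lex*> less_than <*lex*> less_than)" by auto
  then show ?thesis using assms
  proof (induction "(card V, card E, nat (sum up V + sum dn V))" arbitrary: V E a b q up dn X
      rule: wf_induct_rule)
    case less
    show ?case
    proof (rule ccontr)
      assume no: "\<not> ?case"
      interpret least_counterexample k V E a b q up dn X
        by unfold_locales (use less no in blast)+
      show False by (rule impossible)
    qed
  qed
qed

text \<open>Without phantom edges, the interval of admissible numbers has length \<open>cut E a b A - 2 * (k - 1)\<close>, which is at least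
\<open>k - 1\<close>, and hence it contains all residues.\<close>

lemma mod_orientation_of_edge_connected:
  assumes fin: "finite V" "finite E" and ne: "V \<noteq> {}"
    and ends: "\<And>e. e \<in> E \<Longrightarrow> a e \<in> V" "\<And>e. e \<in> E \<Longrightarrow> b e \<in> V"
    and conn: "\<And>A. A \<noteq> {} \<Longrightarrow> A \<subset> V \<Longrightarrow> 3 * k - 3 \<le> cut E a b A"
    and k: "1 \<le> k" and q: "k dvd sum q V - int (card E)"
  shows "\<exists>t. mod_orientation k V E a b q t"
proof (cases "k = 1")
  case True
  then show ?thesis unfolding mod_orientation_def by (intro exI[of _ a]) simp
next
  case False
  then have k2: "2 \<le> k" using k by simp
  have "feasible k V E a b q (\<lambda>_. 0) (\<lambda>_. 0) {}"
    unfolding feasible_def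
  proof (intro conjI ballI allI impI)
    fix A assume A: "A \<noteq> {} \<and> A \<subset> V \<and> A \<noteq> {}"
    define Q where "Q = sum q A - inside E a b A"
    \<comment> \<open>The interval from \<open>k - 1\<close> to \<open>2 * k - 2\<close> contains every residue modulo \<open>k\<close>.\<close>
    define r where "r = k - 1 + (Q - (k - 1)) mod k"
    have "r - Q = - (k * ((Q - (k - 1)) div k))"
      unfolding r_def using mult_div_mod_eq[of k "Q - (k - 1)"] by linarith
    then have "k dvd r - Q" by simp
    moreover have "k - 1 \<le> r" "r \<le> 2 * k - 2" 
      unfolding r_def using k2 pos_mod_sign[of k "Q - (k - 1)"] pos_mod_bound[of k "Q - (k - 1)"] by linarith+
    moreover have "3 * k - 3 \<le> cut E a b A" using conn A by blast
    ultimately show "admissible k E a b q (\<lambda>_. 0) (\<lambda>_. 0) 0 0 A"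
      unfolding admissible_def Q_def by (intro exI[of _ r]) simp
  qed (use k2 fin ne ends q in \<open>auto simp: budget_def\<close>)
  then show ?thesis by (rule mod_orientation_exists)
qed

section \<open>Balanced orientations and equitable colourings\<close>

lemma balanced_orientation:
  assumes "finite E"
  shows "\<exists>t. (\<forall>e\<in>E. t e = a e \<or> t e = b e) \<and>
     (\<forall>v. \<bar>2 * outs E t v - (outs E a v + outs E b v)\<bar> \<le> 1)"
  using assms
proof (induction "card E" arbitrary: E a b rule: less_induct)
  case less
  note fin = less.prems
  show ?case
  proof (cases "\<exists>v. 2 \<le> cut E a b {v}")
    case True
    \<comment> \<open>Two edges at \<open>v\<close> are lifted to one edge that bypasses \<open>v\<close>; in the end it is replaced by a path through \<open>v\<close>.\<close>
    then obtain v where v: "2 \<le> cut E a b {v}" by blast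
    define D where "D = {e \<in> E. (a e = v) \<noteq> (b e = v)}"
    have "cut E a b {v} = int (card D)" unfolding cut_def D_def using fin by (simp add: Int_def)
    then have "2 \<le> card D" using v by simp
    then obtain e1 e2 where e12: "e1 \<in> D" "e2 \<in> D" "e1 \<noteq> e2"
      by (metis card_2_iff' obtain_subset_with_card_n subsetD)
    then have e: "e1 \<in> E" "e2 \<in> E" unfolding D_def by auto
    obtain y where y: "{a e1, b e1} = {v, y}" using e12(1) unfolding D_def by auto
    obtain w where w: "{a e2, b e2} = {v, w}" using e12(2) unfolding D_def by auto
    have "card (E - {e2}) < card E" using e fin by (meson card_Diff1_less)
    from less.hyps[OF this, of "a(e1 := y)" "b(e1 := w)"] fin
    obtain t where t: "\<And>e. e \<in> E - {e2} \<Longrightarrow> t e = (a(e1 := y)) e \<or> t e = (b(e1 := w)) e"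
      and tb: "\<And>u. \<bar>2 * outs (E - {e2}) t u -
         (outs (E - {e2}) (a(e1 := y)) u + outs (E - {e2}) (b(e1 := w)) u)\<bar> \<le> 1" by blast
    obtain s where s: "\<And>e. e \<in> E \<Longrightarrow> s e = a e \<or> s e = b e"
      "\<And>u. outs E s u = outs (E - {e2}) t u + of_bool (u = v)"
      using unlift[OF fin e e12(3) y w t] by blast
    have deg: "outs (E - {e2}) (a(e1 := y)) u + outs (E - {e2}) (b(e1 := w)) u =
       outs E a u + outs E b u - 2 * of_bool (u = v)" for u
    proof -
      have fE': "finite (E - {e2})" "e1 \<in> E - {e2}" using fin e e12(3) by auto
      have c: "outs (E - {e2} - {e1}) (f(e1 := z)) u = outs (E - {e2} - {e1}) f u" for f z
        by (intro outs_cong) auto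
      have f: "outs (E - {e2}) (f(e1 := z)) u = 
          outs E f u - of_bool (f e2 = u) - of_bool (f e1 = u) + of_bool (z = u)" for f z
        using outs_remove[OF fin e(2), of f u] outs_remove[OF fE', of f u] 
          outs_remove[OF fE', of "f(e1 := z)" u] c[of f z] by simp
      have "a e1 = v \<and> b e1 = y \<or> a e1 = y \<and> b e1 = v" "a e2 = v \<and> b e2 = w \<or> a e2 = w \<and> b e2 = v"
        using y w by (auto simp: doubleton_eq_iff)
      then show ?thesis unfolding f by (elim disjE conjE) simp_all
    qed
    have "\<bar>2 * outs E s u - (outs E a u + outs E b u)\<bar> \<le> 1" for u
      using tb[of u] unfolding deg s(2) by simp
    then show ?thesis using s(1) by blast
  next
    case False
    \<comment> \<open>No two edges that are not loops meet, so every orientation is balanced.\<close>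
    have "\<bar>2 * outs E a v - (outs E a v + outs E b v)\<bar> \<le> 1" for v
    proof -
      have "2 * outs E a v - (outs E a v + outs E b v) = (\<Sum>e\<in>E. of_bool (a e = v) - of_bool (b e = v))"
        unfolding outs_def by (simp only: sum_subtractf)
      also have "\<bar>\<dots>\<bar> \<le> (\<Sum>e\<in>E. \<bar>of_bool (a e = v) - of_bool (b e = v)\<bar>)" by (rule sum_abs)
      also have "\<dots> = cut E a b {v}" unfolding cut_def by (intro sum.cong) auto
      finally show ?thesis using False not_le[of 2 "cut E a b {v}"] by force
    qed
    then show ?thesis by blast
  qed
qed

lemma equitable_halves:
  fixes l :: "'e \<Rightarrow> 'a" and r :: "'e \<Rightarrow> 'b"
  assumes "finite E"
  obtains R where "R \<subseteq> E" "\<And>x. \<bar>outs R l x - outs (E - R) l x\<bar> \<le> 1"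
    "\<And>y. \<bar>outs R r y - outs (E - R) r y\<bar> \<le> 1"
proof -
  \<comment> \<open>Each edge joins a cell of \<open>l\<close> to a cell of \<open>r\<close>; in a balanced orientation of this bipartite graph the edges oriented
    from left to right form one half.\<close>
  define a where "a e = (Inl (l e) :: 'a + 'b)" for e
  define b where "b e = (Inr (r e) :: 'a + 'b)" for e
  obtain t where t: "\<And>e. e \<in> E \<Longrightarrow> t e = a e \<or> t e = b e"
    "\<And>v. \<bar>2 * outs E t v - (outs E a v + outs E b v)\<bar> \<le> 1"
    using balanced_orientation[OF assms, of a b] by blast
  define R where "R = {e \<in> E. t e = a e}"
  have RE: "R \<subseteq> E" unfolding R_def by auto
  have "outs E a (Inl x) = outs E l x" "outs E b (Inl x) = 0"
    "outs E a (Inr y) = 0" "outs E b (Inr y) = outs E r y" for x y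
    unfolding outs_def a_def b_def by simp_all
  moreover have "outs E t (Inl x) = outs R l x" for x
  proof -
    have "outs E t (Inl x) = outs R t (Inl x) + outs (E - R) t (Inl x)" by (rule outs_split[OF assms RE])
    also have "outs (E - R) t (Inl x) = 0" unfolding outs_def
    proof (intro sum.neutral ballI)
      fix e assume "e \<in> E - R"
      then have "t e = b e" using t(1)[of e] unfolding R_def by auto
      then show "of_bool (t e = Inl x) = (0 :: int)" unfolding b_def by simp
    qed
    also have "outs R t (Inl x) = outs R l x" unfolding outs_def
      by (intro sum.cong) (auto simp: R_def a_def)
    finally show ?thesis by simp
  qed
  moreover have "outs E t (Inr y) = outs (E - R) r y" for y
  proof -
    have "outs E t (Inr y) = outs R t (Inr y) + outs (E - R) t (Inr y)" by (rule outs_split[OF assms RE])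
    also have "outs R t (Inr y) = 0" unfolding outs_def
      by (intro sum.neutral) (auto simp: R_def a_def)
    also have "outs (E - R) t (Inr y) = outs (E - R) r y" unfolding outs_def
    proof (intro sum.cong refl)
      fix e assume "e \<in> E - R"
      then have "t e = b e" using t(1)[of e] unfolding R_def by auto
      then show "of_bool (t e = Inr y) = (of_bool (r e = y) :: int)" unfolding b_def by simp
    qed
    finally show ?thesis by simp
  qed
  ultimately have "\<bar>outs R l x - outs (E - R) l x\<bar> \<le> 1" "\<bar>outs R r y - outs (E - R) r y\<bar> \<le> 1" for x y
    using t(2)[of "Inl x"] t(2)[of "Inr y"] outs_split[OF assms RE, of l x] outs_split[OF assms RE, of r y]
    by simp_all
  then show thesis using that RE by blast
qed

definition colour_class :: "'e set \<Rightarrow> ('e \<Rightarrow> nat) \<Rightarrow> nat \<Rightarrow> 'e set" where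
  "colour_class E c i = {e \<in> E. c e = i}"

lemma outs_colours:
  assumes "finite E" "finite J"
  shows "outs {e \<in> E. c e \<in> J} t v = (\<Sum>j\<in>J. outs (colour_class E c j) t v)"
proof -
  have "{e \<in> E. c e \<in> J} = (\<Union>j\<in>J. colour_class E c j)" unfolding colour_class_def by auto
  then show ?thesis unfolding outs_def
    using assms by (simp only:) (intro sum.UNION_disjoint, auto simp: colour_class_def)
qed

lemma sum_colour_classes:
  assumes "finite E" "\<And>e. e \<in> E \<Longrightarrow> c e < k"
  shows "(\<Sum>j<k. outs (colour_class E c j) t v) = outs E t v"
proof -
  have "{e \<in> E. c e \<in> {..<k}} = E" using assms(2) by auto
  moreover have "outs {e \<in> E. c e \<in> {..<k}} t v = (\<Sum>j<k. outs (colour_class E c j) t v)"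
    by (rule outs_colours) (use assms in auto)
  ultimately show ?thesis by simp
qed

lemma squares_decrease:
  fixes x y x' y' :: int
  assumes "x + y = x' + y'" "\<bar>x' - y'\<bar> \<le> 1"
  shows "x'^2 + y'^2 \<le> x^2 + y^2" "2 \<le> \<bar>x - y\<bar> \<Longrightarrow> x'^2 + y'^2 < x^2 + y^2"
proof -
  have id: "2 * (u^2 + v^2) = (u + v)^2 + (u - v)^2" for u v :: int
    by (simp add: power2_eq_square algebra_simps)
  have par: "\<bar>x' - y'\<bar> \<le> \<bar>x - y\<bar>"
  proof (rule ccontr)
    assume less: "\<not> \<bar>x' - y'\<bar> \<le> \<bar>x - y\<bar>"
    then have "x = y" using assms(2) by linarith
    then show False using assms less by presburger
  qed
  then have "(x' - y')^2 \<le> (x - y)^2" by (simp add: abs_le_square_iff)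
  then show "x'^2 + y'^2 \<le> x^2 + y^2" using id[of x y] id[of x' y'] assms(1) by simp
  assume "2 \<le> \<bar>x - y\<bar>"
  then have "\<bar>x' - y'\<bar> < \<bar>x - y\<bar>" using assms(2) by linarith
  then have "(x' - y')^2 < (x - y)^2" 
    by (metis abs_ge_zero power2_abs power_strict_mono zero_less_numeral)
  then show "x'^2 + y'^2 < x^2 + y^2" using id[of x y] id[of x' y'] assms(1) by simp
qed

lemma outs_two_colours:
  assumes "finite E" "i \<noteq> j" "R \<subseteq> colour_class E c i \<union> colour_class E c j"
  shows "outs (colour_class E c i) f x + outs (colour_class E c j) f x =
    outs R f x + outs (colour_class E c i \<union> colour_class E c j - R) f x"
proof -
  let ?D = "colour_class E c i \<union> colour_class E c j"
  have finD: "finite ?D" using assms(1) unfolding colour_class_def by auto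
  have "?D - colour_class E c i = colour_class E c j"
    using assms(2) unfolding colour_class_def by auto
  then show ?thesis
    using outs_split[OF finD, of "colour_class E c i" f x] outs_split[OF finD assms(3), of f x] by simp
qed

lemma equitable_colouring:
  fixes l :: "'e \<Rightarrow> 'a" and r :: "'e \<Rightarrow> 'b"
  assumes fin: "finite E" and k: "0 < k"
  obtains c where "\<And>e. e \<in> E \<Longrightarrow> c e < k"
    "\<And>i j x. i < k \<Longrightarrow> j < k \<Longrightarrow> \<bar>outs (colour_class E c i) l x - outs (colour_class E c j) l x\<bar> \<le> 1"
    "\<And>i j y. i < k \<Longrightarrow> j < k \<Longrightarrow> \<bar>outs (colour_class E c i) r y - outs (colour_class E c j) r y\<bar> \<le> 1"
proof -
  define cnt where "cnt D z = (case z of Inl x \<Rightarrow> outs D l x | Inr y \<Rightarrow> outs D r y)" for D :: "'e set" and z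
  define Z where "Z = Inl ` l ` E \<union> Inr ` r ` E"
  have finZ: "finite Z" unfolding Z_def using fin by simp
  \<comment> \<open>A colouring with the least sum of squares is equitable, as halving the union of two colours that differ by at least 2
    somewhere would decrease the sum.\<close>
  define \<Phi> where "\<Phi> c = nat (\<Sum>z\<in>Z. \<Sum>i<k. (cnt (colour_class E c i) z)^2)" for c
  obtain c where c: "\<forall>e\<in>E. c e < k" "\<And>c'. \<forall>e\<in>E. c' e < k \<Longrightarrow> \<Phi> c \<le> \<Phi> c'"
    using ex_has_least_nat[of "\<lambda>c. \<forall>e\<in>E. c e < k" "\<lambda>_. 0" \<Phi>] k by auto
  have main: "\<bar>cnt (colour_class E c i) z - cnt (colour_class E c j) z\<bar> \<le> 1" if ij: "i < k" "j < k" for i j z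
  proof (rule ccontr)
    assume "\<not> ?thesis"
    then have big: "2 \<le> \<bar>cnt (colour_class E c i) z - cnt (colour_class E c j) z\<bar>" by linarith
    have neq: "i \<noteq> j" using big by auto
    have zZ: "z \<in> Z"
    proof (rule ccontr)
      assume "z \<notin> Z"
      then have "cnt (colour_class E c u) z = 0" for u
        unfolding cnt_def Z_def outs_def colour_class_def 
        by (auto split: sum.split intro!: sum.neutral)
      then show False using big by simp
    qed
    define D where "D = colour_class E c i \<union> colour_class E c j"
    have finD: "finite D" using fin unfolding D_def colour_class_def by auto
    obtain R where R: "R \<subseteq> D" "\<And>x. \<bar>outs R l x - outs (D - R) l x\<bar> \<le> 1"
      "\<And>y. \<bar>outs R r y - outs (D - R) r y\<bar> \<le> 1"
      using equitable_halves[OF finD, of l r] by blast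
    define c' where "c' e = (if e \<in> R then i else if e \<in> D then j else c e)" for e
    have c'k: "\<forall>e\<in>E. c' e < k" using c(1) ij unfolding c'_def by auto
    have cls: "colour_class E c' i = R" "colour_class E c' j = D - R"
      using R(1) neq unfolding colour_class_def c'_def D_def by auto
    have other: "colour_class E c' u = colour_class E c u" if "u \<noteq> i" "u \<noteq> j" for u
      using R(1) that unfolding colour_class_def c'_def D_def by auto
    have sum_eq: "cnt (colour_class E c i) z + cnt (colour_class E c j) z = cnt R z + cnt (D - R) z" for z
      unfolding cnt_def D_def
      by (cases z) (simp_all add: outs_two_colours[OF fin neq R(1)[unfolded D_def]])
    have bal: "\<bar>cnt R z - cnt (D - R) z\<bar> \<le> 1" for z
      unfolding cnt_def using R by (cases z) auto
    define f where "f c z = (\<Sum>u<k. (cnt (colour_class E c u) z)^2)" for c z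
    have f_split: "f d z = (cnt (colour_class E d i) z)^2 + (cnt (colour_class E d j) z)^2 +
       (\<Sum>u\<in>{..<k} - {i} - {j}. (cnt (colour_class E d u) z)^2)" for d z
      unfolding f_def using ij neq by (simp add: sum.remove[of "{..<k}" i] sum.remove[of "{..<k} - {i}" j])
    have rest: "(\<Sum>u\<in>{..<k} - {i} - {j}. (cnt (colour_class E c' u) z)^2) =
       (\<Sum>u\<in>{..<k} - {i} - {j}. (cnt (colour_class E c u) z)^2)" for z
      by (intro sum.cong) (auto simp: other)
    have le: "f c' z \<le> f c z" for z
      unfolding f_split rest cls using squares_decrease(1)[OF sum_eq bal] by simp
    have lt: "f c' z < f c z"
      unfolding f_split rest cls using squares_decrease(2)[OF sum_eq bal big] by simp
    have "(\<Sum>z\<in>Z. f c' z) < (\<Sum>z\<in>Z. f c z)"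
      using finZ zZ le lt by (intro sum_strict_mono_ex1) auto
    moreover have "0 \<le> (\<Sum>z\<in>Z. f c' z)" unfolding f_def by (intro sum_nonneg) auto
    ultimately have "\<Phi> c' < \<Phi> c" unfolding \<Phi>_def f_def by simp
    then show False using c(2)[OF c'k] by simp
  qed
  show thesis
  proof (rule that)
    show "c e < k" if "e \<in> E" for e using c(1) that by blast
    show "\<bar>outs (colour_class E c i) l x - outs (colour_class E c j) l x\<bar> \<le> 1" if "i < k" "j < k" for i j x
      using main[OF that, of "Inl x"] unfolding cnt_def by simp
    show "\<bar>outs (colour_class E c i) r y - outs (colour_class E c j) r y\<bar> \<le> 1" if "i < k" "j < k" for i j y
      using main[OF that, of "Inr y"] unfolding cnt_def by simp
  qed
qed

lemma equitable_lower:
  fixes n :: "nat \<Rightarrow> int"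
  assumes "\<And>i j. i < k \<Longrightarrow> j < k \<Longrightarrow> \<bar>n i - n j\<bar> \<le> 1" "int k * x \<le> (\<Sum>i<k. n i)" "i < k"
  shows "x \<le> n i"
proof (rule ccontr)
  assume "\<not> ?thesis"
  then have i: "n i < x" by simp
  have "(\<Sum>j<k. n j) < (\<Sum>j<k. x)"
  proof (rule sum_strict_mono_ex1)
    show "\<forall>j\<in>{..<k}. n j \<le> x" using assms(1)[OF assms(3)] i by force
    show "\<exists>j\<in>{..<k}. n j < x" using i assms(3) by blast
  qed simp
  then show False using assms(2) by simp
qed

lemma equitable_upper:
  fixes n :: "nat \<Rightarrow> int"
  assumes "\<And>i j. i < k \<Longrightarrow> j < k \<Longrightarrow> \<bar>n i - n j\<bar> \<le> 1" "(\<Sum>i<k. n i) \<le> int k * x" "i < k"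
  shows "n i \<le> x"
  using equitable_lower[of k "\<lambda>i. - n i" "- x" i] assms by (simp add: sum_negf abs_minus_commute)

text \<open>In a balanced orientation all in- and outdegrees are at least \<open>n\<close>, hence each colour of an equitable colouring
enters and leaves each vertex.\<close>

lemma split_into_2_factors:
  assumes fin: "finite E" and deg: "\<And>v. v \<in> V \<Longrightarrow> 2 * int n \<le> outs E a v + outs E b v"
  obtains c where "\<And>i v. i < n \<Longrightarrow> v \<in> V \<Longrightarrow>
    2 \<le> outs (colour_class E c i) a v + outs (colour_class E c i) b v"
proof (cases "n = 0")
  case True
  then show ?thesis using that by simp
next
  case False
  obtain t where t: "\<And>e. e \<in> E \<Longrightarrow> t e = a e \<or> t e = b e"
    "\<And>v. \<bar>2 * outs E t v - (outs E a v + outs E b v)\<bar> \<le> 1"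
    using balanced_orientation[OF fin, of a b] by blast
  define h where "h = (\<lambda>e. if t e = a e then b e else a e)"
  have n0: "0 < n" using False by simp
  obtain c where c: "\<And>e. e \<in> E \<Longrightarrow> c e < n"
    "\<And>i j x. i < n \<Longrightarrow> j < n \<Longrightarrow> \<bar>outs (colour_class E c i) t x - outs (colour_class E c j) t x\<bar> \<le> 1"
    "\<And>i j y. i < n \<Longrightarrow> j < n \<Longrightarrow> \<bar>outs (colour_class E c i) h y - outs (colour_class E c j) h y\<bar> \<le> 1"
    using equitable_colouring[OF fin n0, of t h] by blast
  have classes: "(\<Sum>j<n. outs (colour_class E c j) f v) = outs E f v" for f v
    using fin c(1) by (rule sum_colour_classes)
  show ?thesis
  proof (rule that)
    fix i v assume i: "i < n" and v: "v \<in> V"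
    have "outs E t v + outs E h v = outs E a v + outs E b v"
      unfolding h_def using t(1) by (rule outs_reorient)
    then have th: "int n \<le> outs E t v" "int n \<le> outs E h v" using t(2)[of v] deg[OF v] by linarith+
    have "1 \<le> outs (colour_class E c i) t v"
      using th(1) classes[of t v] i
      by (intro equitable_lower[of n "\<lambda>i. outs (colour_class E c i) t v"] c(2)) auto
    moreover have "1 \<le> outs (colour_class E c i) h v"
      using th(2) classes[of h v] i
      by (intro equitable_lower[of n "\<lambda>i. outs (colour_class E c i) h v"] c(3)) auto
    moreover have "outs (colour_class E c i) t v + outs (colour_class E c i) h v =
       outs (colour_class E c i) a v + outs (colour_class E c i) b v"
      unfolding h_def using t(1) by (intro outs_reorient) (auto simp: colour_class_def)
    ultimately show "2 \<le> outs (colour_class E c i) a v + outs (colour_class E c i) b v" by linarith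
  qed
qed

section \<open>Colour classes of large minimum degree\<close>

lemma bounded_sum:
  fixes e :: "'v \<Rightarrow> int"
  assumes "finite V" "\<And>v. v \<in> V \<Longrightarrow> 0 \<le> e v" "0 \<le> T" "T \<le> sum e V"
  shows "\<exists>q. (\<forall>v\<in>V. 0 \<le> q v \<and> q v \<le> e v) \<and> sum q V = T"
  using assms
proof (induction V arbitrary: T rule: finite_induct)
  case empty
  then show ?case by auto
next
  case (insert x V)
  define y where "y = min T (e x)"
  have "0 \<le> sum e V" using insert by (intro sum_nonneg) auto
  then have "0 \<le> T - y" "T - y \<le> sum e V" using insert unfolding y_def by auto
  then obtain q where q: "\<forall>v\<in>V. 0 \<le> q v \<and> q v \<le> e v" "sum q V = T - y"
    using insert.IH[of "T - y"] insert.prems by auto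
  have "sum (q(x := y)) V = sum q V" using insert by (intro sum.cong) auto
  then have "sum (q(x := y)) (insert x V) = T" using q insert by simp
  moreover have "\<forall>v\<in>insert x V. 0 \<le> (q(x := y)) v \<and> (q(x := y)) v \<le> e v"
    using q insert unfolding y_def by auto
  ultimately show ?case by blast
qed

text \<open>Here \<open>e\<close> is the excess of the degrees over \<open>k * p\<close> and \<open>M\<close> is the number of edges, so that \<open>M\<close> is congruent to half the total excess
if the number of vertices is even, and to half of the total excess plus or minus \<open>k\<close> if it is odd. The second case of the
conclusion is for an odd number of vertices and a total excess less than \<open>k\<close>, when no value between 0 and the total excess has the right residue.\<close>

lemma residues:
  fixes e :: "'v \<Rightarrow> int" and k s :: nat and p M :: int
  assumes fin: "finite V" and e0: "\<And>v. v \<in> V \<Longrightarrow> 0 \<le> e v" and ne: "V \<noteq> {}"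
    and tot: "2 * M = int k * p * int (card V) + sum e V"
    and sk: "s \<le> k" "even (int k - int s)" and p: "odd p"
    and cond: "even (card V) \<or> int s - 1 \<le> sum e V"
  obtains q where "int k dvd sum q V - M" "\<And>v. v \<in> V \<Longrightarrow> 0 \<le> q v \<and> q v \<le> e v"
  | q u g where "int k dvd sum q V - M" "u \<in> V" "\<And>v. v \<in> V - {u} \<Longrightarrow> 0 \<le> q v \<and> q v \<le> e v"
     "q u = e u + int g" "e u + int g < int k" "2 * g + s \<le> k"
proof -
  note within = that(1) and beyond = that(2)
  have s0: "0 \<le> sum e V" using e0 by (intro sum_nonneg)
  have first: thesis if T: "2 * T = sum e V - int k * x" "int k dvd T - M" "0 \<le> x" "int k * x \<le> sum e V" for T x
  proof -
    have "0 \<le> int k * x" using T(3) by simp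
    then have "0 \<le> T" "T \<le> sum e V" using T s0 by linarith+
    then obtain q where "\<forall>v\<in>V. 0 \<le> q v \<and> q v \<le> e v" "sum q V = T"
      using bounded_sum[of V e T, OF fin e0] by blast
    then show thesis using within[of q] T(2) by auto
  qed
  show thesis
  proof (cases "even (card V)")
    case True
    then obtain n where n: "card V = 2 * n" by blast
    have "2 * (M - int k * p * int n) = sum e V - int k * 0" using tot n by (simp add: algebra_simps)
    then show thesis using first[of "M - int k * p * int n" 0] s0 by simp
  next
    case odd: False
    then have "odd (p * int (card V))" using p by simp
    then obtain w where w: "p * int (card V) = 2 * w + 1" by (rule oddE)
    have tot': "2 * M = 2 * (int k * w) + int k + sum e V"
      using tot arg_cong[OF w, of "\<lambda>z. int k * z"] by (simp add: algebra_simps)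
    show thesis
    proof (cases "int k \<le> sum e V")
      case True
      have "2 * (M - int k * w - int k) = sum e V - int k * 1" using tot' by simp
      moreover have "int k dvd (M - int k * w - int k) - M" by (simp add: dvd_diff)
      ultimately show thesis using first[of "M - int k * w - int k" 1] True by simp
    next
      case False
      \<comment> \<open>Even the largest residues \<open>q = e\<close> sum up to less than what is needed; any vertex can take the difference \<open>g\<close>.\<close>
      obtain u where u: "u \<in> V" using ne by blast
      define g where "g = nat (M - int k * w - sum e V)"
      have gg: "int g = M - int k * w - sum e V" unfolding g_def using tot' False by simp
      have eu: "e u \<le> sum e V" using fin u e0 by (intro member_le_sum) auto
      define q where "q = e(u := e u + int g)"
      have "sum q V = sum e V + int g" unfolding q_def using sum_fun_upd_int[OF fin, of e u] u by simp
      then have "sum q V - M = - (int k * w)" using gg by simp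
      then have "int k dvd sum q V - M" by simp
      moreover have "e u + int g < int k" using gg eu tot' False by linarith
      moreover have "2 * g + s \<le> k"
      proof -
        have "even (sum e V - int k)"
        proof -
          have "sum e V - int k = 2 * (M - int k * w - int k)" using tot' by simp
          then show ?thesis by (simp only: dvd_triv_left)
        qed
        then have "even (sum e V - int s)" using sk(2) by presburger
        moreover have "int s - 1 \<le> sum e V" using cond odd by simp
        ultimately have "int s \<le> sum e V" by presburger
        then show ?thesis using gg tot' by linarith
      qed
      ultimately show thesis using beyond[of q u g] u e0 unfolding q_def by auto
    qed
  qed
qed

text \<open>The \<open>k\<close> classes of an equitable colouring have degree at least \<open>p\<close> everywhere, except possibly at one vertex \<open>u\<close> whose residue exceeds its excess
by \<open>g\<close>. There \<open>g\<close> classes lack an in-edge and at least \<open>g\<close> classes have an additional out-edge. Because of \<open>2 * g + s \<le> k\<close> there are \<open>s\<close>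
classes that avoid the former and leave enough of the latter to the remaining classes.\<close>

lemma factor_classes:
  fixes E :: "'e set" and a b :: "'e \<Rightarrow> 'v" and k s :: nat and p :: int
  assumes finV: "finite V" and ne: "V \<noteq> {}" and finE: "finite E"
    and ends: "\<And>e. e \<in> E \<Longrightarrow> a e \<in> V" "\<And>e. e \<in> E \<Longrightarrow> b e \<in> V"
    and orient: "\<And>q. int k dvd sum q V - int (card E) \<Longrightarrow> \<exists>t. mod_orientation (int k) V E a b q t"
    and deg: "\<And>v. v \<in> V \<Longrightarrow> int k * p \<le> outs E a v + outs E b v"
    and k0: "0 < k" and sk: "s \<le> k" "even (int k - int s)" and p: "odd p"
    and cond: "even (card V) \<or> int s - 1 \<le> (\<Sum>v\<in>V. outs E a v + outs E b v - int k * p)"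
  obtains c S where "\<And>e. e \<in> E \<Longrightarrow> c e < k" "S \<subseteq> {..<k}" "card S = s"
    "\<And>v j. v \<in> V \<Longrightarrow> j \<in> S \<Longrightarrow> p \<le> outs (colour_class E c j) a v + outs (colour_class E c j) b v"
    "\<And>v. v \<in> V \<Longrightarrow> int (k - s) * p \<le> outs {e \<in> E. c e \<notin> S} a v + outs {e \<in> E. c e \<notin> S} b v"
proof -
  define x where "x v = outs E a v + outs E b v - int k * p" for v
  have x0: "0 \<le> x v" if "v \<in> V" for v using deg[OF that] unfolding x_def by simp
  have "sum x V = 2 * int (card E) - int k * p * int (card V)"
    unfolding x_def sum_subtractf using handshake[OF finV, of E a b] ends by simp
  then have tot: "2 * int (card E) = int k * p * int (card V) + sum x V" by simp
  \<comment> \<open>At \<open>v\<close>, the numbers \<open>f j\<close> and \<open>g j\<close> of out- and in-edges of colour \<open>j\<close> differ by at most one between colours.\<close>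
  have colour: "\<exists>c y. (\<forall>e\<in>E. c e < k) \<and> (\<forall>v\<in>V. \<exists>f g. 
      (\<forall>j. f j + g j = outs (colour_class E c j) a v + outs (colour_class E c j) b v) \<and>
      (\<forall>i<k. \<forall>j<k. \<bar>f i - f j\<bar> \<le> 1 \<and> \<bar>g i - g j\<bar> \<le> 1) \<and>
      sum f {..<k} = int k * y v + q v \<and> sum g {..<k} = int k * (p - y v) + x v - q v)"
    if q: "int k dvd sum q V - int (card E)" for q
  proof -
    obtain t where t: "mod_orientation (int k) V E a b q t" using orient[OF q] by blast
    have te: "t e = a e \<or> t e = b e" if "e \<in> E" for e using t that unfolding mod_orientation_def by blast
    define h where "h = (\<lambda>e. if t e = a e then b e else a e)"
    obtain c where c: "\<And>e. e \<in> E \<Longrightarrow> c e < k"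
      "\<And>i j v. i < k \<Longrightarrow> j < k \<Longrightarrow> \<bar>outs (colour_class E c i) t v - outs (colour_class E c j) t v\<bar> \<le> 1"
      "\<And>i j v. i < k \<Longrightarrow> j < k \<Longrightarrow> \<bar>outs (colour_class E c i) h v - outs (colour_class E c j) h v\<bar> \<le> 1"
      using equitable_colouring[OF finE k0, of t h] by blast
    have classes: "(\<Sum>j<k. outs (colour_class E c j) f v) = outs E f v" for f v
      using finE c(1) by (rule sum_colour_classes)
    have th: "outs D t v + outs D h v = outs D a v + outs D b v" if "D \<subseteq> E" for D v
      unfolding h_def using te that by (intro outs_reorient) auto
    have "\<forall>v\<in>V. \<exists>y. outs E t v = int k * y + q v"
    proof
      fix v assume "v \<in> V"
      then have "int k dvd outs E t v - q v" using t unfolding mod_orientation_def by blast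
      then obtain y where "outs E t v - q v = int k * y" by blast
      then show "\<exists>y. outs E t v = int k * y + q v" by (intro exI[of _ y]) simp
    qed
    then obtain y where y: "\<And>v. v \<in> V \<Longrightarrow> outs E t v = int k * y v + q v" by metis
    have "\<exists>f g. 
      (\<forall>j. f j + g j = outs (colour_class E c j) a v + outs (colour_class E c j) b v) \<and>
      (\<forall>i<k. \<forall>j<k. \<bar>f i - f j\<bar> \<le> 1 \<and> \<bar>g i - g j\<bar> \<le> 1) \<and>
      sum f {..<k} = int k * y v + q v \<and> sum g {..<k} = int k * (p - y v) + x v - q v" 
      if v: "v \<in> V" for v
    proof (rule exI[of _ "\<lambda>j. outs (colour_class E c j) t v"], rule exI[of _ "\<lambda>j. outs (colour_class E c j) h v"],
        intro conjI)
      show "\<forall>j. outs (colour_class E c j) t v + outs (colour_class E c j) h v =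
          outs (colour_class E c j) a v + outs (colour_class E c j) b v"
        by (intro allI th) (auto simp: colour_class_def)
      show "\<forall>i<k. \<forall>j<k. \<bar>outs (colour_class E c i) t v - outs (colour_class E c j) t v\<bar> \<le> 1 \<and>
          \<bar>outs (colour_class E c i) h v - outs (colour_class E c j) h v\<bar> \<le> 1"
        using c(2,3) by blast
      show "(\<Sum>j<k. outs (colour_class E c j) t v) = int k * y v + q v"
        using classes[of t v] y[OF v] by simp
      have "outs E h v = int k * p + x v - (int k * y v + q v)"
        using th[of E v] y[OF v] unfolding x_def by simp
      then show "(\<Sum>j<k. outs (colour_class E c j) h v) = int k * (p - y v) + x v - q v"
        using classes[of h v] by (simp add: algebra_simps)
    qed
    then show ?thesis using c(1) by blast
  qed
  define d where "d c j v = outs (colour_class E c j) a v + outs (colour_class E c j) b v" for c j v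
  have normal: "p \<le> f j + g j" if f: "\<forall>i<k. \<forall>j<k. \<bar>f i - f j\<bar> \<le> 1 \<and> \<bar>g i - g j\<bar> \<le> 1"
      "sum f {..<k} = int k * y + q" "sum g {..<k} = int k * (p - y) + x - q" "0 \<le> q" "q \<le> x" "j < k"
    for f g :: "nat \<Rightarrow> int" and y q x j
  proof -
    have "y \<le> f j" by (rule equitable_lower[of k f]) (use f in auto)
    moreover have "p - y \<le> g j" by (rule equitable_lower[of k g]) (use f in auto)
    ultimately show ?thesis by simp
  qed
  have rest: "outs {e \<in> E. c e \<notin> S} a v + outs {e \<in> E. c e \<notin> S} b v = (\<Sum>j\<in>{..<k} - S. d c j v)"
    if "\<forall>e\<in>E. c e < k" for c S v
  proof -
    have "{e \<in> E. c e \<notin> S} = {e \<in> E. c e \<in> {..<k} - S}" using that by auto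
    moreover have "outs {e \<in> E. c e \<in> {..<k} - S} f v = (\<Sum>j\<in>{..<k} - S. outs (colour_class E c j) f v)" for f
      by (rule outs_colours) (use finE in auto)
    ultimately show ?thesis unfolding d_def sum.distrib by simp
  qed
  have card_rest: "card ({..<k} - S) = k - s" if "S \<subseteq> {..<k}" "card S = s" for S
    using that by (simp add: card_Diff_subset finite_subset)
  have rest_normal: "int (k - s) * p \<le> (\<Sum>j\<in>{..<k} - S. d c j v)"
    if "\<And>j. j < k \<Longrightarrow> p \<le> d c j v" "S \<subseteq> {..<k}" "card S = s" for c S v
    using sum_bounded_below[of "{..<k} - S" p "\<lambda>j. d c j v"] that card_rest[OF that(2,3)] by simp
  have cond': "even (card V) \<or> int s - 1 \<le> sum x V" using cond unfolding x_def .
  show thesis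
  proof (rule residues[of V x "int (card E)" k p s])
    fix q
    assume 1: "int k dvd sum q V - int (card E)" "\<And>v. v \<in> V \<Longrightarrow> 0 \<le> q v \<and> q v \<le> x v"
    obtain c y where c: "\<forall>e\<in>E. c e < k" and fg: "\<forall>v\<in>V. \<exists>f g. 
      (\<forall>j. f j + g j = d c j v) \<and>
      (\<forall>i<k. \<forall>j<k. \<bar>f i - f j\<bar> \<le> 1 \<and> \<bar>g i - g j\<bar> \<le> 1) \<and>
      sum f {..<k} = int k * y v + q v \<and> sum g {..<k} = int k * (p - y v) + x v - q v"
      using colour[OF 1(1)] unfolding d_def by blast
    have all: "p \<le> d c j v" if v: "v \<in> V" and j: "j < k" for v j
    proof -
      obtain f g where f: "\<And>j. f j + g j = d c j v"
        "\<forall>i<k. \<forall>j<k. \<bar>f i - f j\<bar> \<le> 1 \<and> \<bar>g i - g j\<bar> \<le> 1"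
        "sum f {..<k} = int k * y v + q v" "sum g {..<k} = int k * (p - y v) + x v - q v"
        using fg v by blast
      show ?thesis using normal[OF f(2,3,4) _ _ j] 1(2)[OF v] f(1)[of j] by simp
    qed
    have S: "{..<s} \<subseteq> {..<k}" "card {..<s} = s" using sk by auto
    show thesis
    proof (rule that[of c "{..<s}"])
      show "p \<le> outs (colour_class E c j) a v + outs (colour_class E c j) b v"
        if "v \<in> V" "j \<in> {..<s}" for v j using all[OF that(1), of j] that(2) sk unfolding d_def by simp
      show "int (k - s) * p \<le> outs {e \<in> E. c e \<notin> {..<s}} a v + outs {e \<in> E. c e \<notin> {..<s}} b v"
        if "v \<in> V" for v unfolding rest[OF c] using all[OF that] S by (rule rest_normal)
    qed (use c S in auto)
  next
    fix q u g0
    assume 2: "int k dvd sum q V - int (card E)" "u \<in> V"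
      "\<And>v. v \<in> V - {u} \<Longrightarrow> 0 \<le> q v \<and> q v \<le> x v"
      "q u = x u + int g0" "x u + int g0 < int k" "2 * g0 + s \<le> k"
    obtain c y where c: "\<forall>e\<in>E. c e < k" and fg: "\<forall>v\<in>V. \<exists>f g. 
      (\<forall>j. f j + g j = d c j v) \<and>
      (\<forall>i<k. \<forall>j<k. \<bar>f i - f j\<bar> \<le> 1 \<and> \<bar>g i - g j\<bar> \<le> 1) \<and>
      sum f {..<k} = int k * y v + q v \<and> sum g {..<k} = int k * (p - y v) + x v - q v"
      using colour[OF 2(1)] unfolding d_def by blast
    have others: "p \<le> d c j v" if v: "v \<in> V" "v \<noteq> u" and j: "j < k" for v j
    proof -
      obtain f g where f: "\<And>j. f j + g j = d c j v"
        "\<forall>i<k. \<forall>j<k. \<bar>f i - f j\<bar> \<le> 1 \<and> \<bar>g i - g j\<bar> \<le> 1"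
        "sum f {..<k} = int k * y v + q v" "sum g {..<k} = int k * (p - y v) + x v - q v"
        using fg v by blast
      show ?thesis using normal[OF f(2,3,4) _ _ j] 2(3)[of v] v f(1)[of j] by simp
    qed
    obtain f g where f: "\<And>j. f j + g j = d c j u"
        "\<forall>i<k. \<forall>j<k. \<bar>f i - f j\<bar> \<le> 1 \<and> \<bar>g i - g j\<bar> \<le> 1"
        "sum f {..<k} = int k * y u + q u" "sum g {..<k} = int k * (p - y u) + x u - q u"
      using fg 2(2) by blast
    have kk: "int k * z + int k = int k * (z + 1)" for z by (simp add: algebra_simps)
    have f01: "f j = y u + of_bool (y u < f j)" if "j < k" for j
    proof -
      have "y u \<le> f j" by (rule equitable_lower[of k f]) (use f(2,3) 2(4) x0[OF 2(2)] that in auto)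
      moreover have "f j \<le> y u + 1" 
        by (rule equitable_upper[of k f]) (use f(2,3) 2(4,5) that kk[of "y u"] in auto)
      ultimately show ?thesis by auto
    qed
    have g01: "g j = p - y u - of_bool (g j < p - y u)" if "j < k" for j
    proof -
      have "sum g {..<k} = int k * (p - y u) - int g0" using f(4) 2(4) by simp
      moreover have "int g0 \<le> int k" using 2(6) by simp
      ultimately have b: "int k * (p - y u - 1) \<le> sum g {..<k}" "sum g {..<k} \<le> int k * (p - y u)"
        using kk[of "p - y u - 1"] by auto
      have "g j \<le> p - y u" by (rule equitable_upper[of k g]) (use f(2) b that in auto)
      moreover have "p - y u - 1 \<le> g j" by (rule equitable_lower[of k g]) (use f(2) b that in auto)
      ultimately show ?thesis by auto
    qed
    \<comment> \<open>Classes in which \<open>u\<close> has one more out-edge than usual, and classes in which it lacks an in-edge.\<close>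
    define P where "P = {j \<in> {..<k}. y u < f j}"
    define M where "M = {j \<in> {..<k}. g j < p - y u}"
    have cardP: "int (card P) = q u"
    proof -
      have "sum f {..<k} = (\<Sum>j<k. y u + of_bool (y u < f j))" using f01 by (intro sum.cong) auto
      also have "\<dots> = int k * y u + int (card P)"
        unfolding sum.distrib P_def by (simp add: Int_def)
      finally show ?thesis using f(3) by simp
    qed
    have cardM: "card M = g0"
    proof -
      have "sum g {..<k} = (\<Sum>j<k. (p - y u) - of_bool (g j < p - y u))" using g01 by (intro sum.cong) auto
      also have "\<dots> = int k * (p - y u) - int (card M)"
        unfolding sum_subtractf M_def by (simp add: Int_def right_diff_distrib)
      finally show ?thesis using f(4) 2(4) by simp
    qed
    have "g0 \<le> card P" using cardP 2(4) x0[OF 2(2)] by linarith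
    \<comment> \<open>The \<open>g0\<close> deficient classes \<open>M\<close> are balanced by as many surplus classes \<open>T\<close>; the classes in \<open>S\<close> are chosen outside
      both, so that what is left over has full degree at \<open>u\<close>.\<close>
    then obtain T where T: "T \<subseteq> P" "card T = g0" by (meson obtain_subset_with_card_n)
    have finTM: "finite T" "finite M" using T finite_subset[of T P] unfolding P_def M_def by auto
    have sub: "M \<union> T \<subseteq> {..<k}" using T unfolding P_def M_def by auto
    have "card (M \<union> T) \<le> 2 * g0" using card_Un_le[of M T] cardM T by simp
    then have "s \<le> card ({..<k} - (M \<union> T))"
      using 2(6) card_Diff_subset[of "M \<union> T" "{..<k}"] finTM sub by simp
    then obtain S where S: "S \<subseteq> {..<k} - (M \<union> T)" "card S = s" by (meson obtain_subset_with_card_n)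
    have Sk: "S \<subseteq> {..<k}" using S by auto
    have uS: "p \<le> d c j u" if "j \<in> S" for j
    proof -
      have "j < k" "j \<notin> M" using that S by auto
      then have "p - y u \<le> g j" unfolding M_def by simp
      moreover have "0 \<le> (of_bool (y u < f j) :: int)" by simp
      then have "y u \<le> f j" using f01[OF \<open>j < k\<close>] by linarith
      ultimately show ?thesis using f(1)[of j] by linarith
    qed
    have uR: "int (k - s) * p \<le> (\<Sum>j\<in>{..<k} - S. d c j u)"
    proof -
      have "int (k - s) * p = (\<Sum>j\<in>{..<k} - S. p)" using card_rest[OF Sk S(2)] by simp
      also have "\<dots> = (\<Sum>j\<in>{..<k} - S. p) + int (card T) - int (card M)" using T cardM by simp
      also have "\<dots> = (\<Sum>j\<in>{..<k} - S. p + of_bool (j \<in> T) - of_bool (j \<in> M))"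
      proof -
        have "({..<k} - S) \<inter> T = T" "({..<k} - S) \<inter> M = M" using S sub by auto
        then show ?thesis by (simp add: sum.distrib sum_subtractf)
      qed
      also have "\<dots> \<le> (\<Sum>j\<in>{..<k} - S. d c j u)"
      proof (rule sum_mono)
        fix j assume j: "j \<in> {..<k} - S"
        then have jk: "j < k" by simp
        have "of_bool (j \<in> T) \<le> (of_bool (y u < f j) :: int)" using T unfolding P_def by auto
        moreover have "of_bool (j \<in> M) = (of_bool (g j < p - y u) :: int)" using jk unfolding M_def by simp
        ultimately show "p + of_bool (j \<in> T) - of_bool (j \<in> M) \<le> d c j u"
          using f01[OF jk] g01[OF jk] f(1)[of j] by linarith
      qed
      finally show ?thesis .
    qed
    show thesis
    proof (rule that[of c S])
      show "p \<le> outs (colour_class E c j) a v + outs (colour_class E c j) b v"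
        if "v \<in> V" "j \<in> S" for v j 
        using others[OF that(1), of j] uS[OF that(2)] that(2) Sk unfolding d_def by (cases "v = u") auto
      show "int (k - s) * p \<le> outs {e \<in> E. c e \<notin> S} a v + outs {e \<in> E. c e \<notin> S} b v"
        if "v \<in> V" for v
      proof (cases "v = u")
        case True then show ?thesis unfolding rest[OF c] using uR by simp
      next
        case False
        show ?thesis unfolding rest[OF c] using others[OF that False] Sk S(2) by (rule rest_normal)
      qed
    qed (use c S Sk in auto)
  qed (use finV x0 ne tot sk p cond' in auto)
qed

lemma blocks:
  assumes "finite I" "I \<noteq> {}"
  shows "\<exists>blk :: nat \<Rightarrow> 'i. (\<forall>j. blk j \<in> I) \<and> (\<forall>i\<in>I. card {j. j < sum n I \<and> blk j = i} = n i)"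
  using assms
proof (induction I rule: finite_ne_induct)
  case (singleton x)
  show ?case by (rule exI[of _ "\<lambda>_. x"]) simp
next
  case (insert x I)
  then obtain blk :: "nat \<Rightarrow> 'i" where blk: "\<And>j. blk j \<in> I" "\<And>i. i \<in> I \<Longrightarrow> card {j. j < sum n I \<and> blk j = i} = n i"
    by blast
  define B where "B j = (if j < sum n I then blk j else x)" for j
  have tot: "sum n (insert x I) = sum n I + n x" using insert by simp
  have "card {j. j < sum n (insert x I) \<and> B j = i} = n i" if "i \<in> insert x I" for i
  proof (cases "i = x")
    case True
    have "{j. j < sum n (insert x I) \<and> B j = i} = {sum n I..<sum n I + n x}"
      unfolding tot B_def True using blk(1) insert(3) by (auto split: if_splits)
    then show ?thesis using True by simp
  next
    case False
    then have "{j. j < sum n (insert x I) \<and> B j = i} = {j. j < sum n I \<and> blk j = i}"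
      unfolding tot B_def by auto
    then show ?thesis using blk(2) that False by simp
  qed
  moreover have "\<forall>j. B j \<in> insert x I" using blk(1) unfolding B_def by auto
  ultimately show ?case by blast
qed

section \<open>Decompositions into factors\<close>

lemma choose_ends:
  obtains a b where "\<And>e. ends G e = Upair (a e) (b e)"
proof -
  have "\<forall>e. \<exists>x. ends G e = Upair (fst x) (snd x)"
    by (metis uprod_exhaust fst_conv snd_conv)
  then obtain f where "\<And>e. ends G e = Upair (fst (f e)) (snd (f e))" by metis
  then show thesis by (rule that)
qed

lemma int_card_filter: "finite A \<Longrightarrow> int (card {x \<in> A. P x}) = (\<Sum>x\<in>A. of_bool (P x))"
  by (simp add: Int_def)

lemma degree_eq_outs:
  assumes "finite (edges H)" "\<And>e. e \<in> edges H \<Longrightarrow> ends H e = Upair (a e) (b e)"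
  shows "int (degree H v) = outs (edges H) a v + outs (edges H) b v"
proof -
  have "{e \<in> edges H. v \<in> set_uprod (ends H e)} = {e \<in> edges H. a e = v \<or> b e = v}"
    using assms(2) by auto
  moreover have "{e \<in> edges H. ends H e = Upair v v} = {e \<in> edges H. a e = v \<and> b e = v}"
    using assms(2) by auto
  ultimately have "int (degree H v) = (\<Sum>e\<in>edges H. of_bool (a e = v \<or> b e = v)) +
     (\<Sum>e\<in>edges H. of_bool (a e = v \<and> b e = v))"
    unfolding degree_def by (simp only: of_nat_add int_card_filter[OF assms(1)])
  also have "\<dots> = outs (edges H) a v + outs (edges H) b v"
    unfolding outs_def sum.distrib[symmetric] by (intro sum.cong) auto
  finally show ?thesis .
qed

lemma cut_degree_eq_cut:
  assumes "finite (edges G)" "\<And>e. ends G e = Upair (a e) (b e)"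
  shows "int (cut_degree G A) = cut (edges G) a b A"
proof -
  have "{e \<in> edges G. \<exists>u v. ends G e = Upair u v \<and> u \<in> A \<and> v \<notin> A} =
     {e \<in> edges G. (a e \<in> A) \<noteq> (b e \<in> A)}"
    using assms(2) by auto
  then show ?thesis unfolding cut_degree_def cut_def by (simp only: int_card_filter[OF assms(1)])
qed

lemma min_degree_iff:
  assumes "is_graph H"
  shows "d \<le> min_degree H \<longleftrightarrow> (\<forall>v\<in>verts H. d \<le> degree H v)"
  using assms unfolding is_graph_def min_degree_def by simp

lemma decomposition_degree:
  fixes G :: "('v, 'e) multigraph" and m :: nat
  assumes H: "edge_decomposition G {1..m} H" and G: "is_graph G"
    and ab: "\<And>e. ends G e = Upair (a e) (b e)"
  shows "int (degree G v) = (\<Sum>i=1..m. outs (edges (H i)) a v + outs (edges (H i)) b v)"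
proof -
  have fin: "finite (edges G)" using G unfolding is_graph_def by simp
  have U: "edges G = (\<Union>i\<in>{1..m}. edges (H i))" and dis: "disjoint_family_on (\<lambda>i. edges (H i)) {1..m}"
    using H unfolding edge_decomposition_def by auto
  have "outs (edges G) f v = (\<Sum>i=1..m. outs (edges (H i)) f v)" for f :: "'e \<Rightarrow> 'v"
    unfolding outs_def
  proof (subst U, rule sum.UNION_disjoint)
    show "\<forall>i\<in>{1..m}. finite (edges (H i))" using fin U by (auto intro: finite_subset)
    show "\<forall>i\<in>{1..m}. \<forall>j\<in>{1..m}. i \<noteq> j \<longrightarrow> edges (H i) \<inter> edges (H j) = {}"
      using dis unfolding disjoint_family_on_def by simp
  qed simp
  then show ?thesis using degree_eq_outs[OF fin ab] by (simp add: sum.distrib)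
qed

text \<open>In a factor, the sum of degrees is even. For odd \<open>\<delta> i\<close> and an odd number of vertices it therefore exceeds the sum of the lower bounds \<open>\<delta> i\<close>.\<close>

lemma excess_of_decomposition:
  fixes G :: "('v, 'e) multigraph" and m :: nat
  assumes H: "edge_decomposition G {1..m} H" and G: "is_graph G"
    and deg: "\<And>i. i \<in> {1..m} \<Longrightarrow> \<delta> i \<le> min_degree (H i)"
    and n: "odd (card (verts G))"
  shows "int (card {i\<in>{1..m}. odd (\<delta> i)}) \<le>
     (\<Sum>v\<in>verts G. int (degree G v) - int (\<Sum>i=1..m. \<delta> i))"
proof -
  obtain a b where ab: "\<And>e. ends G e = Upair (a e) (b e)" using choose_ends by blast
  define V where "V = verts G"
  define D where "D i v = outs (edges (H i)) a v + outs (edges (H i)) b v" for i v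
  have fac: "is_graph (H i)" "verts (H i) = V" "\<And>e. e \<in> edges (H i) \<Longrightarrow> ends (H i) e = Upair (a e) (b e)"
    if "i \<in> {1..m}" for i
    using H that ab unfolding edge_decomposition_def is_factor_def V_def by auto
  have finH: "finite (edges (H i))" if "i \<in> {1..m}" for i using fac(1)[OF that] unfolding is_graph_def by simp
  have finV: "finite V" using G unfolding is_graph_def V_def by simp
  have Dd: "int (degree (H i) v) = D i v" if "i \<in> {1..m}" for i v
    unfolding D_def by (rule degree_eq_outs) (use finH fac(3) that in auto)
  have ge: "of_bool (odd (\<delta> i)) \<le> (\<Sum>v\<in>V. D i v - int (\<delta> i))" if i: "i \<in> {1..m}" for i
  proof -
    have nn: "0 \<le> (\<Sum>v\<in>V. D i v - int (\<delta> i))"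
      using deg[OF i] min_degree_iff[OF fac(1)[OF i]] fac(2)[OF i] Dd[OF i]
      by (intro sum_nonneg) (metis diff_ge_0_iff_ge of_nat_le_iff)
    have "a e \<in> V" "b e \<in> V" if "e \<in> edges (H i)" for e
      using fac[OF i] that unfolding is_graph_def by auto
    then have "(\<Sum>v\<in>V. D i v) = 2 * int (card (edges (H i)))"
      unfolding D_def using handshake[OF finV, of "edges (H i)" a b] by blast
    then have "(\<Sum>v\<in>V. D i v - int (\<delta> i)) = 2 * int (card (edges (H i))) - int (card V) * int (\<delta> i)"
      unfolding sum_subtractf by simp
    then have "odd (\<delta> i) \<Longrightarrow> odd (\<Sum>v\<in>V. D i v - int (\<delta> i))" using n unfolding V_def by simp
    then show ?thesis using nn by (cases "odd (\<delta> i)") (auto intro: order.not_eq_order_implies_strict simp: int_one_le_iff_zero_less)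
  qed
  have "int (card {i\<in>{1..m}. odd (\<delta> i)}) = (\<Sum>i=1..m. of_bool (odd (\<delta> i)))"
    by (rule int_card_filter) simp
  also have "\<dots> \<le> (\<Sum>i=1..m. \<Sum>v\<in>V. D i v - int (\<delta> i))" using ge by (intro sum_mono) auto
  also have "\<dots> = (\<Sum>v\<in>V. \<Sum>i=1..m. D i v - int (\<delta> i))" by (rule sum.swap)
  also have "\<dots> = (\<Sum>v\<in>V. int (degree G v) - int (\<Sum>i=1..m. \<delta> i))"
    using decomposition_degree[OF H G ab] unfolding D_def by (simp add: sum_subtractf)
  finally show ?thesis unfolding V_def .
qed

text \<open>Every factor with odd \<open>\<delta> i\<close> receives one class of degree at least \<open>p\<close>; the union \<open>R\<close> of the remaining classes is split into
\<open>N\<close> factors of minimum degree at least 2, which are distributed in blocks of size \<open>n i\<close>.\<close>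

lemma decomposition_exists:
  fixes G :: "('v, 'e) multigraph" and k m :: nat and p :: int and \<delta> :: "nat \<Rightarrow> nat"
  assumes k: "k > 0" and p: "odd p" "p - 1 \<ge> 2"
    and \<delta>p: "\<forall>i\<in>{1..m}. int (\<delta> i) \<ge> p - 1"
    and tot: "int k * p = int (\<Sum>i=1..m. \<delta> i)"
    and G: "is_graph G" and conn: "edge_connected (3 * k - 3) G"
    and deg: "min_degree G \<ge> (\<Sum>i=1..m. \<delta> i)"
    and cond: "even (card (verts G)) \<or> (\<Sum>v\<in>verts G. int (degree G v) - int (\<Sum>i=1..m. \<delta> i))
           \<ge> int (card {i\<in>{1..m}. odd (\<delta> i)}) - 1"
  obtains H :: "nat \<Rightarrow> ('v, 'e) multigraph" where "edge_decomposition G {1..m} H"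
    "\<And>i. i \<in> {1..m} \<Longrightarrow> \<delta> i \<le> min_degree (H i)"
proof -
  obtain a b where ab: "\<And>e. ends G e = Upair (a e) (b e)" using choose_ends by blast
  define V where "V = verts G"
  define E where "E = edges G"
  define I where "I = {1..m}"
  define Od where "Od = {i \<in> I. odd (\<delta> i)}"
  define s where "s = card Od"
  have fin: "finite V" "finite E" and ne: "V \<noteq> {}" and ends: "\<And>e. e \<in> E \<Longrightarrow> a e \<in> V" "\<And>e. e \<in> E \<Longrightarrow> b e \<in> V"
    using G ab unfolding is_graph_def V_def E_def by auto
  have finOd: "finite Od" "finite I" unfolding Od_def I_def by auto
  have dG: "int (degree G v) = outs E a v + outs E b v" for v
    unfolding E_def by (rule degree_eq_outs) (use fin ab in \<open>auto simp: E_def\<close>)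
  have odd_ge: "p \<le> int (\<delta> i)" if "i \<in> Od" for i
  proof -
    have "i \<in> {1..m}" "odd (int (\<delta> i))" using that unfolding Od_def I_def by auto
    then show ?thesis using bspec[OF \<delta>p, of i] p(1) by presburger
  qed
  have tot': "int k * p = (\<Sum>i\<in>I. int (\<delta> i))" using tot unfolding I_def by simp
  have sk: "s \<le> k"
  proof -
    have "int s * p = (\<Sum>i\<in>Od. p)" unfolding s_def by simp
    also have "\<dots> \<le> (\<Sum>i\<in>Od. int (\<delta> i))" by (intro sum_mono odd_ge)
    also have "\<dots> \<le> (\<Sum>i\<in>I. int (\<delta> i))" using finOd by (intro sum_mono2) (auto simp: Od_def)
    finally have "int s * p \<le> int k * p" using tot' by simp
    then show ?thesis using p(2) by simp
  qed
  \<comment> \<open>Factor \<open>i\<close> receives one colour class if \<open>\<delta> i\<close> is odd; \<open>2 * n i\<close> is what is then still missing.\<close>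
  define n where "n i = (if i \<in> Od then nat ((int (\<delta> i) - p) div 2) else \<delta> i div 2)" for i
  have n2: "int (\<delta> i) = 2 * int (n i) + (if i \<in> Od then p else 0)" if "i \<in> I" for i
  proof (cases "i \<in> Od")
    case True
    then have "odd (int (\<delta> i))" unfolding Od_def by simp
    then show ?thesis using True odd_ge[OF True] p(1) unfolding n_def by simp
  next
    case False
    then have "even (\<delta> i)" using that unfolding Od_def by simp
    then obtain h where "\<delta> i = 2 * h" by blast
    then show ?thesis using False unfolding n_def by simp
  qed
  define N where "N = sum n I"
  have N: "2 * int N = int (k - s) * p"
  proof -
    have "int k * p = (\<Sum>i\<in>I. 2 * int (n i) + (if i \<in> Od then p else 0))"
      unfolding tot' using n2 by (intro sum.cong) auto
    also have "\<dots> = 2 * int N + (\<Sum>i\<in>I. if i \<in> Od then p else 0)"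
      unfolding N_def by (simp add: sum.distrib sum_distrib_left)
    also have "(\<Sum>i\<in>I. if i \<in> Od then p else 0) = (\<Sum>i\<in>I \<inter> Od. p)"
      by (rule sum.inter_restrict[symmetric]) (use finOd in auto)
    also have "I \<inter> Od = Od" unfolding Od_def by auto
    finally show ?thesis using sk unfolding s_def by (simp add: of_nat_diff algebra_simps)
  qed
  have par: "even (int k - int s)"
  proof -
    have "even (int (k - s) * p)" using N by (metis dvd_triv_left)
    then show ?thesis using p(1) sk by (simp add: of_nat_diff)
  qed
  have degV: "int k * p \<le> outs E a v + outs E b v" if "v \<in> V" for v
  proof -
    have "(\<Sum>i=1..m. \<delta> i) \<le> degree G v" using deg min_degree_iff[OF G] that unfolding V_def by blast
    then have "int (\<Sum>i=1..m. \<delta> i) \<le> int (degree G v)" by (simp only: of_nat_le_iff)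
    then show ?thesis unfolding tot dG[symmetric] .
  qed
  have conn': "3 * int k - 3 \<le> cut E a b A" if "A \<noteq> {}" "A \<subset> V" for A
  proof -
    have "3 * k - 3 \<le> cut_degree G A" using conn that unfolding edge_connected_def V_def by blast
    then show ?thesis using cut_degree_eq_cut[OF _ ab, of A] fin unfolding E_def by linarith
  qed
  have orient: "\<exists>t. mod_orientation (int k) V E a b q t" if "int k dvd sum q V - int (card E)" for q
    by (rule mod_orientation_of_edge_connected) (use fin ne ends conn' k that in auto)
  have cond': "even (card V) \<or> int s - 1 \<le> (\<Sum>v\<in>V. outs E a v + outs E b v - int k * p)"
    using cond unfolding tot dG V_def s_def Od_def I_def .
  obtain c S where c: "\<And>e. e \<in> E \<Longrightarrow> c e < k" and S: "S \<subseteq> {..<k}" "card S = s"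
    and degS: "\<And>v j. v \<in> V \<Longrightarrow> j \<in> S \<Longrightarrow> p \<le> outs (colour_class E c j) a v + outs (colour_class E c j) b v"
    and degR: "\<And>v. v \<in> V \<Longrightarrow> int (k - s) * p \<le> outs {e \<in> E. c e \<notin> S} a v + outs {e \<in> E. c e \<notin> S} b v"
    using factor_classes[of V E a b k p s] fin ne ends orient degV k sk par p(1) cond' by blast
  define R where "R = {e \<in> E. c e \<notin> S}"
  have finR: "finite R" unfolding R_def using fin by simp
  have "2 * int N \<le> outs R a v + outs R b v" if "v \<in> V" for v using degR[OF that] unfolding N R_def .
  then obtain c2 where c2: "\<And>i v. i < N \<Longrightarrow> v \<in> V \<Longrightarrow>
      2 \<le> outs (colour_class R c2 i) a v + outs (colour_class R c2 i) b v"
    using split_into_2_factors[OF finR, of V N a b] by blast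
  have "I \<noteq> {}" using tot' k p(2) by auto
  then obtain blk where blk: "\<And>j. blk j \<in> I" "\<And>i. i \<in> I \<Longrightarrow> card {j. j < N \<and> blk j = i} = n i"
    using blocks[OF finOd(2), of n] unfolding N_def by blast
  have "finite S" using S(1) finite_subset by blast
  then obtain f where f: "bij_betw f S Od" using finOd(1) S(2) unfolding s_def by (metis finite_same_card_bij)
  define g where "g e = (if c e \<in> S then f (c e) else blk (c2 e))" for e
  define H where "H i = G\<lparr>edges := {e \<in> E. g e = i}\<rparr>" for i
  have gI: "g e \<in> I" for e
    using f blk(1) unfolding g_def bij_betw_def Od_def by auto
  have graphH: "is_graph (H i)" for i
    using G unfolding is_graph_def H_def E_def by auto
  show thesis
  proof (rule that[of H])
    show "edge_decomposition G {1..m} H"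
      unfolding edge_decomposition_def is_factor_def disjoint_family_on_def
      using graphH gI unfolding H_def E_def I_def by auto
  next
    fix i assume "i \<in> {1..m}"
    then have i: "i \<in> I" unfolding I_def .
    define J where "J = {j. j < N \<and> blk j = i}"
    have finJ: "finite J" "card J = n i" using blk(2)[OF i] unfolding J_def by auto
    define B where "B = {e \<in> R. c2 e \<in> J}"
    define A where "A = (if i \<in> Od then colour_class E c (inv_into S f i) else {})"
    have finAB: "finite A" "finite B" using fin finR unfolding A_def B_def colour_class_def by auto
    have invS: "inv_into S f i \<in> S" "f (inv_into S f i) = i" if "i \<in> Od"
      using f that unfolding bij_betw_def by (auto intro: inv_into_into f_inv_into_f)
    have AB: "A \<inter> B = {}" "A \<union> B \<subseteq> edges (H i)"
      using invS unfolding A_def B_def R_def J_def H_def g_def colour_class_def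
      by (auto split: if_splits)
    have "\<delta> i \<le> degree (H i) v" if v: "v \<in> V" for v
    proof -
      have finH: "finite (edges (H i))" unfolding H_def using fin by simp
      have dH: "int (degree (H i) v) = outs (edges (H i)) a v + outs (edges (H i)) b v"
        by (rule degree_eq_outs[OF finH]) (simp add: H_def ab)
      have le: "outs A t v + outs B t v \<le> outs (edges (H i)) t v" for t
        using outs_disjoint_Un[OF finAB AB(1), of t v] outs_mono[OF finH AB(2), of t v] by simp
      have "outs A a v + outs A b v + (outs B a v + outs B b v) \<le> int (degree (H i) v)"
        using dH le[of a] le[of b] by linarith
      moreover have "(if i \<in> Od then p else 0) \<le> outs A a v + outs A b v"
        using degS[OF v invS(1)] unfolding A_def by (simp add: outs_def)
      moreover have "2 * int (n i) \<le> outs B a v + outs B b v"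
      proof -
        have "2 * int (n i) = (\<Sum>j\<in>J. 2)" using finJ by simp
        also have "\<dots> \<le> (\<Sum>j\<in>J. outs (colour_class R c2 j) a v + outs (colour_class R c2 j) b v)"
          using c2 v unfolding J_def by (intro sum_mono) auto
        also have "\<dots> = outs B a v + outs B b v"
          unfolding B_def by (simp only: sum.distrib outs_colours[OF finR finJ(1)])
        finally show ?thesis .
      qed
      ultimately show ?thesis using n2[OF i] by linarith
    qed
    then show "\<delta> i \<le> min_degree (H i)" using min_degree_iff[OF graphH] unfolding H_def V_def by simp
  qed
qed

theorem theorem1p6:
  fixes G :: "('v, 'e) multigraph"
    and k m :: nat and p :: int and \<delta> :: "nat \<Rightarrow> nat"
  assumes "k > 0"
    and "\<forall>i\<in>{1..m}. \<delta> i > 0"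
    and "odd p" and "p - 1 \<ge> 2"
    and "\<forall>i\<in>{1..m}. int (\<delta> i) \<ge> p - 1"
    and "int k * p = int (\<Sum>i=1..m. \<delta> i)"
    and "is_graph G"
    and "edge_connected (3 * k - 3) G"
    and "min_degree G \<ge> (\<Sum>i=1..m. \<delta> i)"
  shows "(\<exists>H :: nat \<Rightarrow> ('v, 'e) multigraph.
            edge_decomposition G {1..m} H \<and> (\<forall>i\<in>{1..m}. min_degree (H i) \<ge> \<delta> i))
     \<longleftrightarrow> even (card (verts G)) \<or>
         (\<Sum>v\<in>verts G. int (degree G v) - int (\<Sum>i=1..m. \<delta> i))
           \<ge> int (card {i\<in>{1..m}. odd (\<delta> i)}) - 1"
    (is "?decomposable \<longleftrightarrow> ?even \<or> ?excess")
proof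
  assume ?decomposable
  then obtain H :: "nat \<Rightarrow> ('v, 'e) multigraph" where "edge_decomposition G {1..m} H"
    "\<And>i. i \<in> {1..m} \<Longrightarrow> \<delta> i \<le> min_degree (H i)" by blast
  from excess_of_decomposition[OF this(1) assms(7) this(2)] show "?even \<or> ?excess" by linarith
next
  assume "?even \<or> ?excess"
  then show ?decomposable
    by (rule decomposition_exists[OF assms(1,3-9)]) blast
qed

end
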